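(* Let $\alpha=\alpha(n)=n/\log^4 n$, and let $\mathcal{I}_n(\alpha)$ denote the family of all $\alpha$-generalized Sidon sets $I\subseteq[n]$ satisfying $|I|\leq \sqrt{n}/\log n$ or $|I|\geq \sqrt{n}/\sqrt{\log n}$. Then for all sufficiently large $n$, $$|\mathcal{I}_n(\alpha)|\leq 2^{180\sqrt{n}}.$$
   Context: All logarithms are to base 2, and $[n]=\{1,\dots,n\}$. A Sidon 4-tuple in a set $A$ of nonnegative integers is an (ordered) 4-tuple $(a,b,c,d)$ of elements of $A$ with $a+b=c+d$ and $\{a,b\}\cap\{c,d\}=\emptyset$. For $\alpha\geq 0$, an $\alpha$-generalized Sidon set in $[n]$ is a set $I\subseteq[n]$ containing at most $\alpha$ Sidon 4-tuples. *)

theory Defs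
  imports Complex_Main
begin

definition sidon_tuples :: "nat set \<Rightarrow> (nat \<times> nat \<times> nat \<times> nat) set" where
  "sidon_tuples A = {(a, b, c, d). a \<in> A \<and> b \<in> A \<and> c \<in> A \<and> d \<in> A \<and>
     a + b = c + d \<and> {a, b} \<inter> {c, d} = {}}"

(* As I is contained in {1..n}, the set of tuples is finite and card counts it. *)
definition generalized_sidon :: "real \<Rightarrow> nat \<Rightarrow> nat set \<Rightarrow> bool" where
  "generalized_sidon \<alpha> n I \<longleftrightarrow> I \<subseteq> {1..n} \<and> real (card (sidon_tuples I)) \<le> \<alpha>"

definition sidon_family :: "nat \<Rightarrow> real \<Rightarrow> nat set set" where
  "sidon_family n \<alpha> = {I. generalized_sidon \<alpha> n I \<and>
     (real (card I) \<le> sqrt (real n) / log 2 (real n) \<or>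
      real (card I) \<ge> sqrt (real n) / sqrt (log 2 (real n)))}"

end

theory Submission
  imports Defs "HOL-Analysis.Analysis" "HOL-Real_Asymp.Real_Asymp"
begin

text \<open>
  Write \<open>L = log 2 n\<close>. The few sets with at most \<open>\<surd>n / L\<close> elements are counted trivially. For a large
  set \<open>I\<close>, averaging gives a seed \<open>S \<subseteq> I\<close> of prescribed size \<open>s\<close> such that few Sidon 4-tuples
  \<open>x + a = y + b\<close> of \<open>I\<close> have \<open>a, b \<in> S\<close>. In the multigraph joining \<open>x\<close> and \<open>y\<close> once for each such
  \<open>(a, b) \<in> S \<times> S\<close>, the set \<open>I - S\<close> spans few edges, while by Cauchy-Schwarz every set of more than
  \<open>4 n / s\<close> vertices spans many. The Kleitman-Winston algorithm therefore encloses \<open>I\<close> in one of few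
  containers of size at most \<open>6 n / s\<close>. Since \<open>I\<close> is only sparse and not independent, removing the
  neighbourhood of a vertex of \<open>I\<close> may lose elements of \<open>I\<close>; these are recorded separately, and the
  assumptions on \<open>\<alpha>\<close> and \<open>|I|\<close> keep their number \<open>O(\<surd>n / L)\<close>.

  The first seed, of size \<open>\<surd>n / L\<close>, is chosen from \<open>{1..n}\<close>; each further seed is twice as large but is
  chosen from the previous container, so that the choices cost \<open>O(\<surd>(s \<surd>n))\<close> bits each, a geometric sum
  dominated by its last term \<open>O(\<surd>n)\<close>.
\<close>

subsection \<open>Counting and averaging\<close>

lemma ex_le_if_sum_le:
  fixes f g :: "'a \<Rightarrow> 'b :: {ordered_cancel_comm_monoid_add, linorder}"
  assumes "finite A" "A \<noteq> {}" "sum f A \<le> sum g A"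
  shows "\<exists>x\<in>A. f x \<le> g x"
proof (rule ccontr)
  assume "\<not> ?thesis"
  then have "sum g A < sum f A" using assms(1,2) by (intro sum_strict_mono) (auto simp: not_le)
  then show False using assms(3) by simp
qed

lemma choose_le_power: "n choose k \<le> n ^ k"
  by (rule order_trans[OF _ binomial_fact_pow]) simp

lemma sum_subsets_power_le:
  fixes b :: "'a :: linordered_idom"
  assumes "finite X" "0 \<le> b"
  shows "(\<Sum>M | M \<subseteq> X \<and> card M \<le> c. b ^ (c - card M)) \<le> (of_nat (card X) + b) ^ c"
proof -
  let ?F = "{M. M \<subseteq> X \<and> card M \<le> c}"
  have "(\<Sum>M\<in>?F. b ^ (c - card M)) = (\<Sum>j\<le>c. \<Sum>M | M \<in> ?F \<and> card M = j. b ^ (c - card M))"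
    using assms(1) by (intro sum.group[symmetric]) auto
  also have "\<dots> = (\<Sum>j\<le>c. of_nat (card X choose j) * b ^ (c - j))"
  proof (intro sum.cong refl)
    fix j assume "j \<in> {..c}"
    then have "{M. M \<in> ?F \<and> card M = j} = {M. M \<subseteq> X \<and> card M = j}" by auto
    then show "(\<Sum>M | M \<in> ?F \<and> card M = j. b ^ (c - card M)) = of_nat (card X choose j) * b ^ (c - j)"
      using assms(1) by (simp add: n_subsets)
  qed
  also have "\<dots> \<le> (\<Sum>j\<le>c. of_nat (c choose j) * of_nat (card X) ^ j * b ^ (c - j))"
  proof (intro sum_mono mult_right_mono)
    fix j assume "j \<in> {..c}"
    then have "1 \<le> c choose j" by (simp add: Suc_le_eq)
    moreover have "card X choose j \<le> card X ^ j" by (rule choose_le_power)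
    ultimately have "card X choose j \<le> (c choose j) * card X ^ j"
      using mult_le_mono by fastforce
    then show "(of_nat (card X choose j) :: 'a) \<le> of_nat (c choose j) * of_nat (card X) ^ j"
      by (metis of_nat_le_iff of_nat_mult of_nat_power)
  qed (use assms in auto)
  also have "\<dots> = (of_nat (card X) + b) ^ c" by (rule binomial_ring[symmetric])
  finally show ?thesis .
qed

lemma card_subsets_card_le:
  assumes "finite X"
  shows "card {M. M \<subseteq> X \<and> card M \<le> c} \<le> (card X + 1) ^ c"
proof -
  have "int (card {M. M \<subseteq> X \<and> card M \<le> c}) \<le> (int (card X) + 1) ^ c"
    using sum_subsets_power_le[OF assms, of "1 :: int" c] by simp
  also have "\<dots> = int ((card X + 1) ^ c)" by (simp add: add.commute)
  finally show ?thesis by (simp only: of_nat_le_iff)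
qed

lemma power_le_fact_mult_exp:
  fixes x :: real
  assumes "0 \<le> x"
  shows "x ^ k \<le> fact k * exp x"
proof -
  have "(\<Sum>i\<in>{k}. x ^ i /\<^sub>R fact i) \<le> (\<Sum>i. x ^ i /\<^sub>R fact i)"
    using assms by (intro sum_le_suminf summable_exp_generic) auto
  then show ?thesis by (simp add: exp_def field_simps)
qed

lemma binomial_le_exp:
  fixes y :: real
  assumes "0 < p" "0 \<le> y" "real k ^ (p - 1) * real N \<le> y ^ p"
  shows "real (N choose k) \<le> exp (p * y)"
proof -
  have "real (N choose k) * fact k ^ p = real ((N choose k) * fact k) * fact k ^ (p - 1)"
    using assms(1) by (simp add: power_eq_if)
  also have "\<dots> \<le> real (N ^ k) * (real k ^ k) ^ (p - 1)"
    using fact_le_power[of k, where 'a = real]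
    by (intro mult_mono power_mono of_nat_mono binomial_fact_pow) auto
  also have "\<dots> = (real k ^ (p - 1) * real N) ^ k"
    by (simp add: power_mult_distrib mult.commute flip: power_mult)
  also have "\<dots> \<le> (y ^ p) ^ k" using assms by (intro power_mono) auto
  also have "\<dots> = (y ^ k) ^ p" by (simp add: mult.commute flip: power_mult)
  also have "\<dots> \<le> (fact k * exp y) ^ p"
    using assms(2) by (intro power_mono power_le_fact_mult_exp) auto
  also have "\<dots> = exp (p * y) * fact k ^ p" by (simp add: power_mult_distrib exp_of_nat_mult)
  finally show ?thesis by simp
qed

lemma card_supersets:
  assumes "finite X" "E \<subseteq> X" "card E \<le> s"
  shows "card {S. S \<subseteq> X \<and> card S = s \<and> E \<subseteq> S} = (card X - card E) choose (s - card E)"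
proof -
  have fin: "finite E" using assms finite_subset by blast
  have "bij_betw (\<lambda>T. T \<union> E) {T. T \<subseteq> X - E \<and> card T = s - card E}
      {S. S \<subseteq> X \<and> card S = s \<and> E \<subseteq> S}"
  proof (rule bij_betwI[where g = "\<lambda>S. S - E"])
    have "card (T \<union> E) = s" if "T \<subseteq> X - E" "card T = s - card E" for T
    proof -
      have "finite T" using that(1) assms(1) by (meson finite_Diff finite_subset)
      then have "card (T \<union> E) = card T + card E"
        using that(1) fin by (intro card_Un_disjoint) auto
      then show ?thesis using that(2) assms(3) by simp
    qed
    then show "(\<lambda>T. T \<union> E) \<in> {T. T \<subseteq> X - E \<and> card T = s - card E}
        \<rightarrow> {S. S \<subseteq> X \<and> card S = s \<and> E \<subseteq> S}"
      using assms(2) by auto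
  qed (use fin in \<open>auto intro!: card_Diff_subset\<close>)
  then have "card {S. S \<subseteq> X \<and> card S = s \<and> E \<subseteq> S} = card {T. T \<subseteq> X - E \<and> card T = s - card E}"
    by (rule bij_betw_same_card[symmetric])
  then show ?thesis
    using assms fin by (simp add: n_subsets card_Diff_subset)
qed

lemma binomial_mult_power_le:
  assumes "s \<le> m"
  shows "(s choose r) * m ^ r \<le> (m choose r) * s ^ r"
proof (cases "r \<le> s")
  case True
  have prod: "real ((a choose r) * b ^ r) = (\<Prod>i=0..<r. real (a - i) / real (r - i) * real b)"
    if "r \<le> a" for a b
    by (simp only: of_nat_mult of_nat_power binomial_altdef_of_nat[OF that] prod.distrib
        prod_constant card_atLeastLessThan diff_zero)
  have "real ((s choose r) * m ^ r) \<le> real ((m choose r) * s ^ r)"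
    unfolding prod[OF True] prod[OF order_trans[OF True assms]]
  proof (intro prod_mono conjI)
    fix i assume "i \<in> {0..<r}"
    then have "real (s - i) * real m \<le> real (m - i) * real s"
      using assms True by (simp add: of_nat_diff algebra_simps mult_left_mono)
    then have "real (s - i) * real m / real (r - i) \<le> real (m - i) * real s / real (r - i)"
      by (rule divide_right_mono) simp
    then show "real (s - i) / real (r - i) * real m \<le> real (m - i) / real (r - i) * real s" by simp
  qed simp
  then show ?thesis by (simp only: of_nat_le_iff)
qed (simp add: binomial_eq_0)

lemma card_supersets_power_le:
  assumes "finite X" "s \<le> card X"
  shows "card {S. S \<subseteq> X \<and> card S = s \<and> E \<subseteq> S} * card X ^ card E \<le> (card X choose s) * s ^ card E"
proof (cases "E \<subseteq> X \<and> card E \<le> s")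
  case True
  then have "(card X choose card E) * (card {S. S \<subseteq> X \<and> card S = s \<and> E \<subseteq> S} * card X ^ card E)
      = (card X choose s) * ((s choose card E) * card X ^ card E)"
    using choose_mult[of "card E" s "card X"] assms by (simp add: card_supersets)
  also have "\<dots> \<le> (card X choose s) * ((card X choose card E) * s ^ card E)"
    using assms(2) by (intro mult_le_mono2 binomial_mult_power_le)
  also have "\<dots> = (card X choose card E) * ((card X choose s) * s ^ card E)" by simp
  finally show ?thesis using True assms(2) by (subst (asm) mult_le_cancel1) simp
next
  case False
  have "E \<subseteq> X \<and> card E \<le> s" if S: "S \<subseteq> X" "card S = s" "E \<subseteq> S" for S
    using card_mono[OF finite_subset[OF S(1) assms(1)] S(3)] S by auto
  then have "{S. S \<subseteq> X \<and> card S = s \<and> E \<subseteq> S} = {}" using False by blast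
  then show ?thesis by (simp only: card.empty mult_0 le0)
qed

lemma ex_subset_few_edges:
  fixes e :: "'q \<Rightarrow> 'a set"
  assumes "finite X" "finite Q" and card_e: "\<And>q. q \<in> Q \<Longrightarrow> card (e q) = r" and "s \<le> card X"
  shows "\<exists>S\<subseteq>X. card S = s \<and> card {q \<in> Q. e q \<subseteq> S} * card X ^ r \<le> card Q * s ^ r"
proof -
  let ?\<S> = "{S. S \<subseteq> X \<and> card S = s}"
  have fin: "finite ?\<S>" using assms(1) by simp
  have "(\<Sum>S\<in>?\<S>. card {q \<in> Q. e q \<subseteq> S}) = (\<Sum>q\<in>Q. card {S \<in> ?\<S>. e q \<subseteq> S})"
    by (rule sum_multicount_gen[OF fin assms(2)]) simp
  then have "(\<Sum>S\<in>?\<S>. card {q \<in> Q. e q \<subseteq> S} * card X ^ r)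
      = (\<Sum>q\<in>Q. card {S \<in> ?\<S>. e q \<subseteq> S} * card X ^ r)"
    by (simp flip: sum_distrib_right)
  also have "\<dots> \<le> (\<Sum>q\<in>Q. card ?\<S> * s ^ r)"
  proof (intro sum_mono)
    fix q assume "q \<in> Q"
    then show "card {S \<in> ?\<S>. e q \<subseteq> S} * card X ^ r \<le> card ?\<S> * s ^ r"
      using card_supersets_power_le[OF assms(1,4), of "e q"] assms(1) card_e
      by (simp add: n_subsets conj_assoc)
  qed
  also have "\<dots> = (\<Sum>S\<in>?\<S>. card Q * s ^ r)" by simp
  finally have "(\<Sum>S\<in>?\<S>. card {q \<in> Q. e q \<subseteq> S} * card X ^ r)
      \<le> (\<Sum>S\<in>?\<S>. card Q * s ^ r)" .
  moreover have "?\<S> \<noteq> {}" using obtain_subset_with_card_n[OF assms(4)] by blast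
  ultimately show ?thesis using ex_le_if_sum_le[OF fin] by blast
qed

subsection \<open>Container families\<close>

definition has_containers :: "real \<Rightarrow> real \<Rightarrow> 'a set \<Rightarrow> 'a set set \<Rightarrow> bool" where
  "has_containers N r U \<J> \<longleftrightarrow> (\<exists>\<C>. finite \<C> \<and> \<C> \<subseteq> Pow U \<and> real (card \<C>) \<le> N \<and>
     (\<forall>C\<in>\<C>. real (card C) \<le> r) \<and> (\<forall>J\<in>\<J>. \<exists>C\<in>\<C>. J \<subseteq> C))"

lemma has_containers_Pow: "real (card U) \<le> r \<Longrightarrow> has_containers 1 r U (Pow U)"
  unfolding has_containers_def by (intro exI[of _ "{U}"]) auto

lemma has_containers_mono:
  assumes "has_containers N r U \<J>" "N \<le> N'" "r \<le> r'" "U \<subseteq> U'" "\<J>' \<subseteq> \<J>"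
  shows "has_containers N' r' U' \<J>'"
proof -
  obtain \<C> where \<C>: "finite \<C>" "\<C> \<subseteq> Pow U" "real (card \<C>) \<le> N" "\<And>C. C \<in> \<C> \<Longrightarrow> real (card C) \<le> r"
    "\<And>J. J \<in> \<J> \<Longrightarrow> \<exists>C\<in>\<C>. J \<subseteq> C"
    using assms(1) unfolding has_containers_def by auto
  show ?thesis
    unfolding has_containers_def
  proof (intro exI[of _ \<C>] conjI ballI)
    show "\<C> \<subseteq> Pow U'" using \<C>(2) assms(4) by auto
    show "real (card \<C>) \<le> N'" using \<C>(3) assms(2) by simp
    show "real (card C) \<le> r'" if "C \<in> \<C>" for C using \<C>(4)[OF that] assms(3) by simp
    show "\<exists>C\<in>\<C>. J \<subseteq> C" if "J \<in> \<J>'" for J using that assms(5) \<C>(5) by auto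
  qed (rule \<C>(1))
qed

lemma has_containers_UN:
  assumes "finite A" "\<And>i. i \<in> A \<Longrightarrow> has_containers (N i) r U (\<J> i)"
  shows "has_containers (\<Sum>i\<in>A. N i) r U (\<Union>i\<in>A. \<J> i)"
proof -
  obtain \<C> where \<C>: "\<forall>i\<in>A. finite (\<C> i) \<and> \<C> i \<subseteq> Pow U \<and> real (card (\<C> i)) \<le> N i \<and>
      (\<forall>C\<in>\<C> i. real (card C) \<le> r) \<and> (\<forall>J\<in>\<J> i. \<exists>C\<in>\<C> i. J \<subseteq> C)"
    using bchoice[OF ballI[OF assms(2)[unfolded has_containers_def]]] ..
  have "real (card (\<Union>i\<in>A. \<C> i)) \<le> real (\<Sum>i\<in>A. card (\<C> i))"
    using card_UN_le[OF assms(1)] by (intro of_nat_mono)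
  also have "\<dots> \<le> (\<Sum>i\<in>A. N i)" unfolding of_nat_sum using \<C> by (intro sum_mono) simp
  finally have "real (card (\<Union>i\<in>A. \<C> i)) \<le> (\<Sum>i\<in>A. N i)" .
  moreover have "finite (\<Union>i\<in>A. \<C> i)" using assms(1) \<C> by simp
  moreover have "(\<Union>i\<in>A. \<C> i) \<subseteq> Pow U" using \<C> by (simp add: UN_subset_iff)
  moreover have "\<forall>C\<in>(\<Union>i\<in>A. \<C> i). real (card C) \<le> r" using \<C> by simp
  moreover have "\<exists>C\<in>(\<Union>i\<in>A. \<C> i). J \<subseteq> C" if "i \<in> A" "J \<in> \<J> i" for i J
    using that \<C> by (meson UN_I)
  ultimately show ?thesis unfolding has_containers_def by (intro exI[of _ "\<Union>i\<in>A. \<C> i"]) simp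
qed

lemma has_containers_Un:
  assumes "has_containers N r U \<J>" "has_containers N' r U \<J>'"
  shows "has_containers (N + N') r U (\<J> \<union> \<J>')"
proof -
  have "has_containers (\<Sum>b\<in>{True, False}. if b then N else N') r U
      (\<Union>b\<in>{True, False}. if b then \<J> else \<J>')"
    using assms by (intro has_containers_UN) auto
  then show ?thesis by (simp add: Un_commute)
qed

lemma has_containers_image_Un:
  assumes "has_containers N r U \<J>"
  shows "has_containers N (real (card A) + r) (A \<union> U) ((\<union>) A ` \<J>)"
proof -
  obtain \<C> where \<C>: "finite \<C>" "\<C> \<subseteq> Pow U" "real (card \<C>) \<le> N" "\<And>C. C \<in> \<C> \<Longrightarrow> real (card C) \<le> r"
    "\<And>J. J \<in> \<J> \<Longrightarrow> \<exists>C\<in>\<C>. J \<subseteq> C"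
    using assms unfolding has_containers_def by auto
  have "real (card (A \<union> C)) \<le> real (card A) + r" if "C \<in> \<C>" for C
    using card_Un_le[of A C] \<C>(4)[OF that] by linarith
  moreover have "\<exists>C\<in>\<C>. A \<union> J \<subseteq> A \<union> C" if "J \<in> \<J>" for J
    using \<C>(5)[OF that] by (meson Un_mono order_refl)
  moreover have "real (card ((\<union>) A ` \<C>)) \<le> N"
    using card_image_le[OF \<C>(1), of "(\<union>) A"] \<C>(3) by linarith
  moreover have "(\<union>) A ` \<C> \<subseteq> Pow (A \<union> U)" using \<C>(2) by auto
  ultimately show ?thesis
    unfolding has_containers_def using \<C>(1) by (intro exI[of _ "(\<union>) A ` \<C>"]) simp
qed

subsection \<open>The Kleitman-Winston algorithm\<close>

lemma sum_card_levels:
  assumes "finite X"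
  shows "(\<Sum>t\<in>{1..k}. card {v \<in> X. t \<le> f v}) = (\<Sum>v\<in>X. min (f v) k)"
proof (rule sum_multicount_gen)
  have "{t \<in> {1..k}. t \<le> f v} = {1..min (f v) k}" for v by auto
  then show "\<forall>v\<in>X. card {t \<in> {1..k}. t \<le> f v} = min (f v) k" by simp
qed (use assms in auto)

text \<open>
  Choosing the level by averaging makes up for the lack of a bound on edge multiplicities.
\<close>

lemma ex_threshold:
  fixes f :: "'a \<Rightarrow> nat" and D :: real
  assumes "finite A" "finite B" and D: "real (\<Sum>v\<in>B. f v) \<le> D" and pos: "0 < (\<Sum>v\<in>A. min (f v) k)"
  shows "\<exists>t\<in>{1..k}. (1 + real (card {v \<in> B. t \<le> f v})) * real (\<Sum>v\<in>A. min (f v) k)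
    \<le> (real k + D) * real (card {v \<in> A. t \<le> f v})"
proof (rule ex_le_if_sum_le)
  let ?W = "real (\<Sum>v\<in>A. min (f v) k)"
  have "(\<Sum>t\<in>{1..k}. (1 + real (card {v \<in> B. t \<le> f v})) * ?W)
      = (real k + real (\<Sum>t\<in>{1..k}. card {v \<in> B. t \<le> f v})) * ?W"
    by (simp only: sum_distrib_right[symmetric] sum.distrib of_nat_sum) simp
  also have "\<dots> = (real k + real (\<Sum>v\<in>B. min (f v) k)) * ?W"
    unfolding sum_card_levels[OF assms(2)] ..
  also have "\<dots> \<le> (real k + D) * ?W"
  proof (intro mult_right_mono add_left_mono order_trans[OF _ D] of_nat_mono)
    show "(\<Sum>v\<in>B. min (f v) k) \<le> (\<Sum>v\<in>B. f v)" by (intro sum_mono) auto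
  qed (rule of_nat_0_le_iff)
  also have "\<dots> = (\<Sum>t\<in>{1..k}. (real k + D) * real (card {v \<in> A. t \<le> f v}))"
    unfolding sum_card_levels[OF assms(1), symmetric] by (simp only: sum_distrib_left of_nat_sum)
  finally show "(\<Sum>t\<in>{1..k}. (1 + real (card {v \<in> B. t \<le> f v})) * ?W)
      \<le> (\<Sum>t\<in>{1..k}. (real k + D) * real (card {v \<in> A. t \<le> f v}))" .
  show "{1..k} \<noteq> {}" using pos by (cases k) auto
qed simp

definition few_edges_subsets :: "('a \<Rightarrow> 'a \<Rightarrow> nat) \<Rightarrow> real \<Rightarrow> 'a set \<Rightarrow> 'a set set" where
  "few_edges_subsets w e U = {J. J \<subseteq> U \<and> real (\<Sum>u\<in>J. \<Sum>v\<in>J - {u}. w u v) \<le> e}"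

text \<open>
  The first factor counts the choices made by the algorithm, the second one the sets of vertices of large
  degree, which are removed in advance.
\<close>

definition label_count :: "nat \<Rightarrow> nat \<Rightarrow> nat \<Rightarrow> nat \<Rightarrow> real" where
  "label_count n k c b = real (n * (n + k) + 1) ^ c * real (n + 1) ^ b"

lemma label_count_nonneg: "0 \<le> label_count n k c b"
  unfolding label_count_def by simp

lemma label_count_mono: "m \<le> n \<Longrightarrow> label_count m k c b \<le> label_count n k c b"
  unfolding label_count_def
  by (intro mult_mono power_mono of_nat_mono add_mono mult_le_mono) auto

locale kleitman_winston =
  fixes w :: "'a \<Rightarrow> 'a \<Rightarrow> nat" and k :: nat and D \<delta> R :: real
  assumes D_pos: "0 < D" and \<delta>_pos: "0 < \<delta>" and R_pos: "0 < R"
begin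

definition sparse_subsets :: "'a set \<Rightarrow> 'a set set" where
  "sparse_subsets U = {J. J \<subseteq> U \<and> (\<forall>u\<in>J. real (\<Sum>v\<in>J - {u}. w u v) \<le> D)}"

definition locally_dense :: "'a set \<Rightarrow> bool" where
  "locally_dense U \<longleftrightarrow> (\<forall>V\<subseteq>U. R < real (card V) \<longrightarrow>
     (\<exists>u\<in>V. \<delta> * real (card V) \<le> real (\<Sum>v\<in>V - {u}. min (w u v) k)))"

definition cost :: "real \<Rightarrow> real" where
  "cost x = (if x \<le> R then 0 else (real k + D) / \<delta> * (1 + ln (x / R)))"

definition survivors :: "'a set \<Rightarrow> 'a \<Rightarrow> nat \<Rightarrow> 'a set" where
  "survivors U u t = {v \<in> U - {u}. w u v < t}"

text \<open>
  When \<open>u\<close> is selected with threshold \<open>t\<close>, the vertices \<open>v\<close> with \<open>t \<le> w u v\<close> are removed from the graph;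
  \<open>M\<close> records the elements of the sparse set that are lost in this way.
\<close>

definition branches :: "nat \<Rightarrow> 'a set \<Rightarrow> 'a \<Rightarrow> (nat \<times> 'a set) set" where
  "branches c U u = {(t, M). t \<in> {1..k} \<and> M \<subseteq> U - {u} \<and>
     1 + real (card M) + cost (real (card (survivors U u t))) \<le> real c}"

lemma locally_dense_subset: "locally_dense U \<Longrightarrow> V \<subseteq> U \<Longrightarrow> locally_dense V"
  unfolding locally_dense_def by (meson subset_trans)

lemma cost_decrease:
  assumes "R < x" "y \<le> x - d" "0 \<le> d" "0 \<le> y"
  shows "(real k + D) / \<delta> * (d / x) + cost y \<le> cost x"
proof -
  have x: "0 < x" using assms(1) R_pos by simp
  have "d / x + (if y \<le> R then 0 else 1 + ln (y / R)) \<le> 1 + ln (x / R)"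
  proof (cases "y \<le> R")
    case True
    have "d / x \<le> 1" using assms x by simp
    moreover have "0 \<le> ln (x / R)" using assms(1) R_pos by simp
    ultimately show ?thesis using True by simp
  next
    case False
    then have y: "0 < y" using R_pos by simp
    have "d / x \<le> 1 - y / x" using assms(2) x by (simp add: field_simps)
    also have "\<dots> \<le> - ln (y / x)" using ln_le_minus_one[of "y / x"] x y by simp
    also have "\<dots> = ln (x / R) - ln (y / R)" using x y R_pos by (simp add: ln_div)
    finally show ?thesis using False by simp
  qed
  then have "(real k + D) / \<delta> * (d / x + (if y \<le> R then 0 else 1 + ln (y / R)))
      \<le> (real k + D) / \<delta> * (1 + ln (x / R))"
    using D_pos \<delta>_pos by (intro mult_left_mono) auto
  moreover have "cost y = (real k + D) / \<delta> * (if y \<le> R then 0 else 1 + ln (y / R))"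
    "cost x = (real k + D) / \<delta> * (1 + ln (x / R))"
    unfolding cost_def using assms(1) by auto
  ultimately show ?thesis by (simp only: distrib_left)
qed

lemma cost_mono:
  assumes "0 \<le> y" "y \<le> x"
  shows "cost y \<le> cost x"
  using assms cost_decrease[of x y 0] by (cases "x \<le> R") (auto simp: cost_def)

lemma cost_nonneg: "0 \<le> x \<Longrightarrow> 0 \<le> cost x"
  using cost_mono[of 0 x] R_pos by (simp add: cost_def)

lemma cost_le:
  assumes "0 \<le> H" "1 + ln (x / R) \<le> H"
  shows "cost x \<le> (real k + D) / \<delta> * H"
proof -
  have nonneg: "0 \<le> (real k + D) / \<delta>" using D_pos \<delta>_pos by simp
  have "0 \<le> (real k + D) / \<delta> * H" using nonneg assms(1) by (rule mult_nonneg_nonneg)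
  moreover have "(real k + D) / \<delta> * (1 + ln (x / R)) \<le> (real k + D) / \<delta> * H"
    using assms(2) nonneg by (rule mult_left_mono)
  ultimately show ?thesis unfolding cost_def by (cases "x \<le> R") (simp_all only: if_True if_False)
qed

lemma ex_cheap_threshold:
  assumes "finite U" "R < real (card U)" "u \<in> J" "J \<in> sparse_subsets U"
    and degree: "\<delta> * real (card U) \<le> real (\<Sum>v\<in>U - {u}. min (w u v) k)"
  shows "\<exists>t\<in>{1..k}. 1 + real (card {v \<in> J - {u}. t \<le> w u v}) +
    cost (real (card (survivors U u t))) \<le> cost (real (card U))"
proof -
  have pos: "0 < \<delta> * real (card U)" using \<delta>_pos R_pos assms(2) by simp
  have J: "J \<subseteq> U" "real (\<Sum>v\<in>J - {u}. w u v) \<le> D"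
    using assms(3,4) unfolding sparse_subsets_def by blast+
  have fin: "finite (U - {u})" "finite (J - {u})" using assms(1) finite_subset[OF J(1)] by blast+
  have "0 < (\<Sum>v\<in>U - {u}. min (w u v) k)" using pos degree by linarith
  then obtain t where t: "t \<in> {1..k}"
    and cheap: "(1 + real (card {v \<in> J - {u}. t \<le> w u v})) * real (\<Sum>v\<in>U - {u}. min (w u v) k)
      \<le> (real k + D) * real (card {v \<in> U - {u}. t \<le> w u v})"
    using ex_threshold[OF fin J(2)] by blast
  define d where "d = card {v \<in> U - {u}. t \<le> w u v}"
  define M where "M = {v \<in> J - {u}. t \<le> w u v}"
  have "(1 + real (card M)) * (\<delta> * real (card U)) \<le> (real k + D) * real d"
    using mult_left_mono[OF degree, of "1 + real (card M)"] cheap unfolding M_def d_def by linarith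
  then have "1 + real (card M) \<le> (real k + D) * real d / (\<delta> * real (card U))"
    using pos by (simp add: pos_le_divide_eq)
  also have "\<dots> = (real k + D) / \<delta> * (real d / real (card U))" by simp
  finally have "1 + real (card M) \<le> (real k + D) / \<delta> * (real d / real (card U))" .
  moreover have "(real k + D) / \<delta> * (real d / real (card U)) +
      cost (real (card (survivors U u t))) \<le> cost (real (card U))"
  proof (rule cost_decrease[OF assms(2)])
    have "survivors U u t = (U - {u}) - {v \<in> U - {u}. t \<le> w u v}" unfolding survivors_def by auto
    also have "card \<dots> = card (U - {u}) - d"
      unfolding d_def using fin(1) by (intro card_Diff_subset) auto
    finally have "card (survivors U u t) = card (U - {u}) - d" .
    moreover have "d \<le> card (U - {u})" unfolding d_def using fin(1) by (intro card_mono) auto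
    moreover have "card (U - {u}) \<le> card U" using assms(1) by (intro card_mono) auto
    ultimately show "real (card (survivors U u t)) \<le> real (card U) - real d" by linarith
  qed simp_all
  ultimately show ?thesis using t unfolding M_def by (intro bexI[of _ t]) linarith+
qed

lemma sparse_subsets_mono:
  assumes "finite U" "J \<in> sparse_subsets U" "J' \<subseteq> J" "J' \<subseteq> V"
  shows "J' \<in> sparse_subsets V"
proof -
  have fin: "finite J" using assms(1,2) finite_subset unfolding sparse_subsets_def by blast
  have "real (\<Sum>v\<in>J' - {u}. w u v) \<le> D" if "u \<in> J'" for u
  proof -
    have "(\<Sum>v\<in>J' - {u}. w u v) \<le> (\<Sum>v\<in>J - {u}. w u v)"
      using fin assms(3) by (intro sum_mono2) auto
    also have "real \<dots> \<le> D" using that assms(2,3) unfolding sparse_subsets_def by blast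
    finally show ?thesis by simp
  qed
  then show ?thesis using assms(4) unfolding sparse_subsets_def by blast
qed

lemma sparse_subsets_subset_branches:
  assumes "finite U" "R < real (card U)" "cost (real (card U)) \<le> real c"
    and degree: "\<delta> * real (card U) \<le> real (\<Sum>v\<in>U - {u}. min (w u v) k)"
  shows "sparse_subsets U \<subseteq> sparse_subsets (U - {u}) \<union>
    (\<Union>(t, M)\<in>branches c U u. (\<union>) (insert u M) ` sparse_subsets (survivors U u t))"
proof
  fix J assume J: "J \<in> sparse_subsets U"
  then have JU: "J \<subseteq> U" unfolding sparse_subsets_def by blast
  show "J \<in> sparse_subsets (U - {u}) \<union>
    (\<Union>(t, M)\<in>branches c U u. (\<union>) (insert u M) ` sparse_subsets (survivors U u t))"
  proof (cases "u \<in> J")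
    case False
    then have "J \<in> sparse_subsets (U - {u})"
      using JU by (intro sparse_subsets_mono[OF assms(1) J order_refl]) auto
    then show ?thesis by (rule UnI1)
  next
    case True
    obtain t where t: "t \<in> {1..k}" "1 + real (card {v \<in> J - {u}. t \<le> w u v}) +
        cost (real (card (survivors U u t))) \<le> cost (real (card U))"
      using ex_cheap_threshold[OF assms(1,2) True J degree] by blast
    let ?M = "{v \<in> J - {u}. t \<le> w u v}" and ?J' = "{v \<in> J - {u}. w u v < t}"
    have "?J' \<in> sparse_subsets (survivors U u t)"
      using JU by (intro sparse_subsets_mono[OF assms(1) J]) (auto simp: survivors_def)
    moreover have "J = insert u ?M \<union> ?J'" using True by auto
    ultimately have "J \<in> (\<union>) (insert u ?M) ` sparse_subsets (survivors U u t)" by (rule rev_image_eqI)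
    moreover have "(t, ?M) \<in> branches c U u" using t JU assms(3) unfolding branches_def by auto
    ultimately show ?thesis by (intro UnI2 UN_I[of "(t, ?M)"]) simp_all
  qed
qed

lemma finite_branches: "finite U \<Longrightarrow> finite (branches c U u)"
  by (rule finite_subset[of _ "{1..k} \<times> Pow U"]) (auto simp: branches_def)

lemma branches_count_le:
  fixes b b' :: real
  assumes "finite U" "0 \<le> b" "b + real (card (U - {u})) \<le> b'" "b + real k \<le> b'"
  shows "b ^ c + (\<Sum>(t, M)\<in>branches c U u. b ^ (c - Suc (card M))) \<le> b' ^ c"
proof (cases c)
  case 0
  have "branches 0 U u = {}"
    unfolding branches_def using cost_nonneg by (auto simp: not_le intro: add_pos_nonneg)
  then show ?thesis using 0 by simp
next
  case (Suc c')
  let ?\<M> = "{M. M \<subseteq> U - {u} \<and> card M \<le> c'}"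
  have "branches c U u \<subseteq> {1..k} \<times> ?\<M>"
  proof clarify
    fix t M assume "(t, M) \<in> branches c U u"
    then show "t \<in> {1..k} \<and> M \<in> ?\<M>"
      using cost_nonneg[of "real (card (survivors U u t))"] Suc unfolding branches_def by auto
  qed
  then have "(\<Sum>(t, M)\<in>branches c U u. b ^ (c - Suc (card M)))
      \<le> (\<Sum>(t, M)\<in>{1..k} \<times> ?\<M>. b ^ (c - Suc (card M)))"
    using assms(1,2) by (intro sum_mono2) auto
  also have "\<dots> = real k * (\<Sum>M\<in>?\<M>. b ^ (c' - card M))"
    using Suc by (simp flip: sum.cartesian_product)
  also have "\<dots> \<le> real k * (real (card (U - {u})) + b) ^ c'"
    using assms(1,2) by (intro mult_left_mono sum_subsets_power_le) auto
  also have "\<dots> \<le> real k * b' ^ c'" using assms(2,3) by (intro mult_left_mono power_mono) auto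
  finally have "b ^ c + (\<Sum>(t, M)\<in>branches c U u. b ^ (c - Suc (card M))) \<le> b ^ c + real k * b' ^ c'"
    by simp
  also have "\<dots> \<le> b * b' ^ c' + real k * b' ^ c'"
    using assms(2,3) Suc by (auto intro!: mult_left_mono power_mono)
  also have "\<dots> = (b + real k) * b' ^ c'" by (simp add: distrib_right)
  also have "\<dots> \<le> b' ^ c" using assms(2,4) Suc by (auto intro!: mult_right_mono)
  finally show ?thesis .
qed

lemma has_containers_branches:
  assumes U: "finite U" "u \<in> U" "cost (real (card (U - {u}))) \<le> real c"
    and smaller: "\<And>V c'. V \<subseteq> U - {u} \<Longrightarrow> cost (real (card V)) \<le> real c' \<Longrightarrow>
      has_containers (b ^ c') (R + real c') U (sparse_subsets V)"
  shows "has_containers (b ^ c + (\<Sum>(t, M)\<in>branches c U u. b ^ (c - Suc (card M)))) (R + real c) U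
    (sparse_subsets (U - {u}) \<union>
      (\<Union>(t, M)\<in>branches c U u. (\<union>) (insert u M) ` sparse_subsets (survivors U u t)))"
proof -
  have branch: "has_containers (b ^ (c - Suc (card M))) (R + real c) U
      ((\<union>) (insert u M) ` sparse_subsets (survivors U u t))" if "(t, M) \<in> branches c U u" for t M
  proof -
    have M: "M \<subseteq> U - {u}" "1 + real (card M) + cost (real (card (survivors U u t))) \<le> real c"
      using that unfolding branches_def by auto
    moreover have "0 \<le> cost (real (card (survivors U u t)))" by (rule cost_nonneg) simp
    ultimately have "Suc (card M) \<le> c" by linarith
    then have c: "real (c - Suc (card M)) = real c - real (card M) - 1" by simp
    have "has_containers (b ^ (c - Suc (card M))) (R + real (c - Suc (card M))) U
        (sparse_subsets (survivors U u t))"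
    proof (rule smaller)
      show "survivors U u t \<subseteq> U - {u}" unfolding survivors_def by blast
      show "cost (real (card (survivors U u t))) \<le> real (c - Suc (card M))" using M(2) c by linarith
    qed
    from has_containers_image_Un[OF this, of "insert u M"] show ?thesis
    proof (rule has_containers_mono)
      have "card (insert u M) \<le> Suc (card M)" by (rule card_insert_le_m1) auto
      then show "real (card (insert u M)) + (R + real (c - Suc (card M))) \<le> R + real c"
        unfolding c by linarith
    qed (use U(2) M(1) in auto)
  qed
  have without: "has_containers (b ^ c) (R + real c) U (sparse_subsets (U - {u}))"
    using smaller[OF order_refl U(3)] .
  have "has_containers (\<Sum>(t, M)\<in>branches c U u. b ^ (c - Suc (card M))) (R + real c) U
      (\<Union>(t, M)\<in>branches c U u. (\<union>) (insert u M) ` sparse_subsets (survivors U u t))"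
    by (rule has_containers_UN[OF finite_branches[OF U(1)]])
      (simp only: split_paired_all prod.case branch)
  with without show ?thesis by (rule has_containers_Un)
qed

lemma has_containers_sparse_subsets_step:
  assumes U: "finite U" "u \<in> U" "R < real (card U)" "cost (real (card U)) \<le> real c"
    and degree: "\<delta> * real (card U) \<le> real (\<Sum>v\<in>U - {u}. min (w u v) k)"
    and smaller: "\<And>V c'. V \<subseteq> U - {u} \<Longrightarrow> cost (real (card V)) \<le> real c' \<Longrightarrow>
      has_containers (b ^ c') (R + real c') U (sparse_subsets V)"
    and b: "0 \<le> b" "b + real (card (U - {u})) \<le> b'" "b + real k \<le> b'"
  shows "has_containers (b' ^ c) (R + real c) U (sparse_subsets U)"
proof -
  have "card (U - {u}) \<le> card U" using U(1) by (intro card_mono) auto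
  then have "cost (real (card (U - {u}))) \<le> real c"
    using cost_mono[of "real (card (U - {u}))" "real (card U)"] U(4) by linarith
  from has_containers_branches[OF U(1,2) this smaller] show ?thesis
    by (rule has_containers_mono)
      (simp_all only: branches_count_le[OF U(1) b] order_refl
        sparse_subsets_subset_branches[OF U(1,3,4) degree])
qed

lemma has_containers_sparse_subsets:
  assumes "finite U" "locally_dense U" "cost (real (card U)) \<le> real c"
  shows "has_containers (real (card U * (card U + k) + 1) ^ c) (R + real c) U (sparse_subsets U)"
  using assms
proof (induction "card U" arbitrary: U c rule: less_induct)
  case less
  define N where "N x = real (x * (x + k) + 1)" for x
  have "has_containers (N (card U) ^ c) (R + real c) U (sparse_subsets U)"
  proof (cases "real (card U) \<le> R")
    case True
    have "1 \<le> N (card U) ^ c" unfolding N_def by (intro one_le_power) auto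
    then show ?thesis
      by (rule has_containers_mono[OF has_containers_Pow[OF True]]) (auto simp: sparse_subsets_def)
  next
    case False
    then obtain u where u: "u \<in> U" "\<delta> * real (card U) \<le> real (\<Sum>v\<in>U - {u}. min (w u v) k)"
      using less.prems(2)[unfolded locally_dense_def, rule_format, OF order_refl] by (auto simp: not_le)
    define x where "x = card (U - {u})"
    have card_U: "card U = Suc x" unfolding x_def using less.prems(1) u(1) by (rule card.remove)
    have smaller: "has_containers (N x ^ c') (R + real c') U (sparse_subsets V)"
      if V: "V \<subseteq> U - {u}" "cost (real (card V)) \<le> real c'" for V c'
    proof (rule has_containers_mono)
      have "card V \<le> x" unfolding x_def using V(1) less.prems(1) by (intro card_mono) auto
      then show "N (card V) ^ c' \<le> N x ^ c'"
        unfolding N_def by (intro power_mono of_nat_mono add_mono mult_le_mono) auto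
      show "has_containers (N (card V) ^ c') (R + real c') V (sparse_subsets V)"
        unfolding N_def
      proof (rule less.hyps[OF _ _ _ V(2)])
        show "card V < card U" using \<open>card V \<le> x\<close> card_U by simp
        show "finite V" using V(1) less.prems(1) by (rule finite_subset[OF _ finite_Diff])
        show "locally_dense V" using V(1) by (intro locally_dense_subset[OF less.prems(2)]) auto
      qed
      show "V \<subseteq> U" using V(1) by blast
    qed (rule order_refl)+
    show ?thesis
    proof (rule has_containers_sparse_subsets_step[OF less.prems(1) u(1) _ less.prems(3) u(2) smaller])
      show "N x + real (card (U - {u})) \<le> N (card U)" "N x + real k \<le> N (card U)"
        unfolding x_def[symmetric] card_U N_def by (simp_all add: algebra_simps)
    qed (use False in \<open>simp_all add: N_def\<close>)
  qed
  then show ?case unfolding N_def .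
qed

lemma few_edges_decompose:
  assumes "finite J" "J \<subseteq> U" "real (\<Sum>u\<in>J. \<Sum>v\<in>J - {u}. w u v) \<le> D * real b"
  shows "\<exists>B\<subseteq>J. card B \<le> b \<and> J - B \<in> sparse_subsets U"
proof -
  define B where "B = {u \<in> J. D < real (\<Sum>v\<in>J - {u}. w u v)}"
  have "real (card B) * D = (\<Sum>u\<in>B. D)" by simp
  also have "\<dots> \<le> (\<Sum>u\<in>B. real (\<Sum>v\<in>J - {u}. w u v))" by (intro sum_mono) (auto simp: B_def)
  also have "\<dots> \<le> (\<Sum>u\<in>J. real (\<Sum>v\<in>J - {u}. w u v))"
    using assms(1) by (intro sum_mono2) (auto simp: B_def simp del: of_nat_sum)
  also have "\<dots> \<le> D * real b" using assms(3) by simp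
  finally have "card B \<le> b" using D_pos by (simp add: mult.commute)
  moreover have "J - B \<in> sparse_subsets U"
  proof -
    have "real (\<Sum>v\<in>J - B - {u}. w u v) \<le> D" if "u \<in> J - B" for u
    proof -
      have "(\<Sum>v\<in>J - B - {u}. w u v) \<le> (\<Sum>v\<in>J - {u}. w u v)"
        using assms(1) by (intro sum_mono2) auto
      moreover have "real (\<Sum>v\<in>J - {u}. w u v) \<le> D" using that unfolding B_def by auto
      ultimately show ?thesis by linarith
    qed
    then show ?thesis using assms(2) unfolding sparse_subsets_def by blast
  qed
  moreover have "B \<subseteq> J" unfolding B_def by auto
  ultimately show ?thesis by (intro exI[of _ B]) simp
qed

lemma has_containers_few_edges:
  assumes "finite U" "locally_dense U" "cost (real (card U)) \<le> real c" "e \<le> D * real b"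
  shows "has_containers (label_count (card U) k c b) (R + real c + real b) U (few_edges_subsets w e U)"
proof -
  let ?N = "real (card U * (card U + k) + 1) ^ c"
  let ?\<B> = "{B. B \<subseteq> U \<and> card B \<le> b}"
  have "has_containers ?N (R + real c + real b) U ((\<union>) B ` sparse_subsets U)" if B: "B \<in> ?\<B>" for B
    using has_containers_image_Un[OF has_containers_sparse_subsets[OF assms(1-3)], of B]
    by (rule has_containers_mono) (use B in auto)
  then have "has_containers (\<Sum>B\<in>?\<B>. ?N) (R + real c + real b) U (\<Union>B\<in>?\<B>. (\<union>) B ` sparse_subsets U)"
    using assms(1) by (intro has_containers_UN) auto
  then show ?thesis
  proof (rule has_containers_mono)
    have "real (card ?\<B>) \<le> real (card U + 1) ^ b"
      using card_subsets_card_le[OF assms(1)] by (simp only: of_nat_le_iff flip: of_nat_power)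
    then have "real (card ?\<B>) * ?N \<le> real (card U + 1) ^ b * ?N" by (rule mult_right_mono) simp
    then show "(\<Sum>B\<in>?\<B>. ?N) \<le> label_count (card U) k c b"
      unfolding label_count_def by (simp only: sum_constant mult.commute)
    show "few_edges_subsets w e U \<subseteq> (\<Union>B\<in>?\<B>. (\<union>) B ` sparse_subsets U)"
    proof
      fix J assume "J \<in> few_edges_subsets w e U"
      then have J: "J \<subseteq> U" "real (\<Sum>u\<in>J. \<Sum>v\<in>J - {u}. w u v) \<le> D * real b"
        using assms(4) unfolding few_edges_subsets_def by auto
      from few_edges_decompose[OF finite_subset[OF J(1) assms(1)] J]
      obtain B where B: "B \<subseteq> J" "card B \<le> b" "J - B \<in> sparse_subsets U" by auto
      moreover have "J = B \<union> (J - B)" using B(1) by auto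
      ultimately show "J \<in> (\<Union>B\<in>?\<B>. (\<union>) B ` sparse_subsets U)"
        using J(1) by (intro UN_I[of B] image_eqI[of _ _ "J - B"]) simp_all
    qed
  qed auto
qed

end

subsection \<open>Representations of a difference\<close>

definition same_sum_pairs :: "nat set \<Rightarrow> nat \<Rightarrow> nat \<Rightarrow> (nat \<times> nat) set" where
  "same_sum_pairs S u v = {(a, b). a \<in> S \<and> b \<in> S \<and> u + a = v + b}"

definition same_sum_count :: "nat set \<Rightarrow> nat \<Rightarrow> nat \<Rightarrow> nat" where
  "same_sum_count S u v = card (same_sum_pairs S u v)"

lemma finite_same_sum_pairs: "finite S \<Longrightarrow> finite (same_sum_pairs S u v)"
  by (rule finite_subset[of _ "S \<times> S"]) (auto simp: same_sum_pairs_def)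

lemma finite_sidon_tuples: "finite A \<Longrightarrow> finite (sidon_tuples A)"
  by (rule finite_subset[of _ "A \<times> A \<times> A \<times> A"]) (auto simp: sidon_tuples_def)

lemma sum_same_sum_count:
  assumes "finite S" "finite A" "\<And>u. u \<in> A \<Longrightarrow> finite (B u)"
  shows "(\<Sum>u\<in>A. \<Sum>v\<in>B u. same_sum_count S u v)
    = card (SIGMA u:A. SIGMA v:B u. same_sum_pairs S u v)"
  using assms by (simp add: same_sum_count_def finite_same_sum_pairs)

lemma card_squared_le_collisions:
  assumes "finite A" "finite K" "f ` A \<subseteq> K"
  shows "(card A)\<^sup>2 \<le> card K * card (SIGMA x:A. {y \<in> A. f y = f x})"
proof -
  define r where "r k = card {x \<in> A. f x = k}" for k
  have "card (SIGMA x:A. {y \<in> A. f y = f x}) = (\<Sum>x\<in>A. r (f x))"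
    unfolding r_def using assms(1) by simp
  also have "\<dots> = (\<Sum>k\<in>K. \<Sum>x | x \<in> A \<and> f x = k. r (f x))"
    using sum.group[OF assms, of "\<lambda>x. r (f x)"] by simp
  also have "\<dots> = (\<Sum>k\<in>K. (r k)\<^sup>2)"
    unfolding r_def power2_eq_square by (intro sum.cong refl) simp
  finally have collisions: "card (SIGMA x:A. {y \<in> A. f y = f x}) = (\<Sum>k\<in>K. (r k)\<^sup>2)" .
  have "card A = (\<Sum>k\<in>K. r k)"
    unfolding r_def using sum.group[OF assms, of "\<lambda>_. 1 :: nat"] by simp
  then have "real ((card A)\<^sup>2) = (\<Sum>k\<in>K. real (r k))\<^sup>2" by simp
  also have "\<dots> \<le> (\<Sum>k\<in>K. (real (r k))\<^sup>2) * real (card K)"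
    by (rule sum_squared_le_sum_of_squares)
  also have "\<dots> = real (card K * card (SIGMA x:A. {y \<in> A. f y = f x}))"
    unfolding collisions by simp
  finally show ?thesis by (simp only: of_nat_le_iff)
qed

lemma sum_same_sum_count_ge:
  assumes "U \<subseteq> {1..n}" "S \<subseteq> {1..n}"
  shows "(card S * card U)\<^sup>2 \<le> 2 * n * (\<Sum>u\<in>U. \<Sum>v\<in>U. same_sum_count S u v)"
proof -
  have fin: "finite U" "finite S" using assms finite_subset by blast+
  let ?f = "\<lambda>(u, a). u + a"
  have "bij_betw (\<lambda>(u, v, a, b). ((u, a), (v, b)))
      (SIGMA u:U. SIGMA v:U. same_sum_pairs S u v)
      (SIGMA x:U \<times> S. {y \<in> U \<times> S. ?f y = ?f x})"
    by (rule bij_betwI[where g = "\<lambda>((u, a), (v, b)). (u, v, a, b)"]) (auto simp: same_sum_pairs_def)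
  then have "(\<Sum>u\<in>U. \<Sum>v\<in>U. same_sum_count S u v)
      = card (SIGMA x:U \<times> S. {y \<in> U \<times> S. ?f y = ?f x})"
    using fin by (simp only: sum_same_sum_count bij_betw_same_card)
  moreover have "?f ` (U \<times> S) \<subseteq> {1..2 * n}" using assms by (force simp: subset_iff)
  ultimately show ?thesis
    using card_squared_le_collisions[of "U \<times> S" "{1..2 * n}" ?f] fin
    by (simp add: card_cartesian_product mult.commute)
qed

lemma same_sum_count_self: "same_sum_count S u u = card S"
proof -
  have "same_sum_pairs S u u = (\<lambda>a. (a, a)) ` S" unfolding same_sum_pairs_def by auto
  then show ?thesis unfolding same_sum_count_def by (simp add: card_image inj_on_def)
qed

text \<open>
  Two distinct representations of the same nonzero difference form a Sidon 4-tuple.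
\<close>

lemma sum_same_sum_count_pairs_le:
  assumes "finite S" "finite V" "u \<notin> V"
  shows "(\<Sum>v\<in>V. same_sum_count S u v * (same_sum_count S u v - 1)) \<le> card (sidon_tuples S)"
proof -
  let ?Q = "same_sum_pairs S u"
  have "(\<Sum>v\<in>V. same_sum_count S u v * (same_sum_count S u v - 1))
      = card (SIGMA v:V. SIGMA p:?Q v. ?Q v - {p})"
    using assms finite_same_sum_pairs[OF assms(1)] by (simp add: same_sum_count_def)
  also have "\<dots> \<le> card (sidon_tuples S)"
  proof (rule card_inj_on_le)
    show "inj_on (\<lambda>(v, (a, b), (a', b')). (a, b', a', b)) (SIGMA v:V. SIGMA p:?Q v. ?Q v - {p})"
      by (auto simp: inj_on_def same_sum_pairs_def)
    show "(\<lambda>(v, (a, b), (a', b')). (a, b', a', b)) ` (SIGMA v:V. SIGMA p:?Q v. ?Q v - {p})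
        \<subseteq> sidon_tuples S"
      using assms(3) by (auto simp: sidon_tuples_def same_sum_pairs_def)
  qed (rule finite_sidon_tuples[OF assms(1)])
  finally show ?thesis .
qed

lemma le_min_plus_falling_square:
  fixes m k :: nat
  assumes "0 < k"
  shows "real m \<le> real (min m k) + real (m * (m - 1)) / real k"
proof (cases "m \<le> k")
  case False
  then have "m * k \<le> m * (m - 1)" by simp
  then have "real m * real k \<le> real (m * (m - 1))" by (simp only: of_nat_le_iff flip: of_nat_mult)
  then have "real m \<le> real (m * (m - 1)) / real k" using assms by (simp add: pos_le_divide_eq)
  then show ?thesis by linarith
qed simp

lemma sum_same_sum_count_le:
  assumes "finite S" "finite U" "u \<in> U" "0 < k"
  shows "real (\<Sum>v\<in>U. same_sum_count S u v) \<le> real (card S) +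
    real (\<Sum>v\<in>U - {u}. min (same_sum_count S u v) k) + real (card (sidon_tuples S)) / real k"
proof -
  let ?w = "same_sum_count S u"
  have "real (\<Sum>v\<in>U. ?w v) = real (card S) + (\<Sum>v\<in>U - {u}. real (?w v))"
    using assms(2,3) by (simp add: sum.remove same_sum_count_self)
  also have "\<dots> \<le> real (card S) +
      (\<Sum>v\<in>U - {u}. real (min (?w v) k) + real (?w v * (?w v - 1)) / real k)"
    using assms(4) by (intro add_left_mono sum_mono le_min_plus_falling_square)
  also have "\<dots> = real (card S) + real (\<Sum>v\<in>U - {u}. min (?w v) k) +
      real (\<Sum>v\<in>U - {u}. ?w v * (?w v - 1)) / real k"
    by (simp only: sum.distrib of_nat_sum sum_divide_distrib add.assoc)
  also have "\<dots> \<le> real (card S) + real (\<Sum>v\<in>U - {u}. min (?w v) k) +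
      real (card (sidon_tuples S)) / real k"
    using assms by (intro add_left_mono divide_right_mono of_nat_mono sum_same_sum_count_pairs_le) auto
  finally show ?thesis .
qed

lemma ex_large_truncated_degree:
  assumes U: "U \<subseteq> {1..n}" and S: "S \<subseteq> {1..n}" "S \<noteq> {}"
    and large: "4 * real n / real (card S) < real (card U)"
    and k: "0 < k" "2 * real (card (sidon_tuples S)) \<le> real k * real (card S)"
  shows "\<exists>u\<in>U. (real (card S))\<^sup>2 / (8 * real n) * real (card U)
    \<le> real (\<Sum>v\<in>U - {u}. min (same_sum_count S u v) k)"
proof -
  define s x N where "s = real (card S)" and "x = real (card U)" and "N = real n"
  have fin: "finite U" "finite S" using U S(1) finite_subset by blast+
  have pos: "0 < s" "0 < N" using S fin by (auto simp: s_def N_def card_gt_0_iff)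
  have sx: "4 * N < s * x" using large pos unfolding s_def x_def N_def by (simp add: field_simps)
  then have x: "0 < x" using pos by (smt (verit) zero_less_mult_pos)
  have "real ((card S * card U)\<^sup>2) \<le> real (2 * n * (\<Sum>u\<in>U. \<Sum>v\<in>U. same_sum_count S u v))"
    using sum_same_sum_count_ge[OF U S(1)] by (rule of_nat_mono)
  then have "(s * x)\<^sup>2 \<le> 2 * N * (\<Sum>u\<in>U. real (\<Sum>v\<in>U. same_sum_count S u v))"
    unfolding s_def x_def N_def by simp
  then have "(\<Sum>u\<in>U. s\<^sup>2 * x / (2 * N)) \<le> (\<Sum>u\<in>U. real (\<Sum>v\<in>U. same_sum_count S u v))"
    using pos by (simp add: field_simps power2_eq_square flip: x_def)
  moreover have "U \<noteq> {}" using x unfolding x_def by auto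
  ultimately obtain u where u: "u \<in> U" "s\<^sup>2 * x / (2 * N) \<le> real (\<Sum>v\<in>U. same_sum_count S u v)"
    using ex_le_if_sum_le[OF fin(1)] by blast
  have "real (card (sidon_tuples S)) / real k \<le> s / 2"
    using k unfolding s_def by (simp add: field_simps)
  with u(2) sum_same_sum_count_le[OF fin(2,1) u(1) k(1)]
  have "s\<^sup>2 * x / (2 * N) \<le> 3 / 2 * s + real (\<Sum>v\<in>U - {u}. min (same_sum_count S u v) k)"
    unfolding s_def by linarith
  moreover have "3 / 2 * s \<le> 3 / 4 * (s\<^sup>2 * x / (2 * N))"
    using mult_left_mono[OF less_imp_le[OF sx], of s] pos by (simp add: field_simps power2_eq_square)
  moreover have "s\<^sup>2 / (8 * N) * x = 1 / 4 * (s\<^sup>2 * x / (2 * N))" by simp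
  ultimately have "s\<^sup>2 / (8 * N) * x \<le> real (\<Sum>v\<in>U - {u}. min (same_sum_count S u v) k)" by linarith
  then show ?thesis using u(1) unfolding s_def x_def N_def by blast
qed

subsection \<open>Containers for sets with few Sidon tuples\<close>

definition sidon_subsets :: "real \<Rightarrow> nat \<Rightarrow> nat set \<Rightarrow> nat set set" where
  "sidon_subsets \<alpha> m C = {I. I \<subseteq> C \<and> card I = m \<and> real (card (sidon_tuples I)) \<le> \<alpha>}"

lemma finite_sidon_subsets: "finite C \<Longrightarrow> finite (sidon_subsets \<alpha> m C)"
  unfolding sidon_subsets_def by simp

lemma card_sidon_subsets_le_binomial:
  assumes "finite C"
  shows "real (card (sidon_subsets \<alpha> m C)) \<le> real (card C choose m)"
proof -
  have "card (sidon_subsets \<alpha> m C) \<le> card {I. I \<subseteq> C \<and> card I = m}"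
    unfolding sidon_subsets_def using assms by (intro card_mono) auto
  then show ?thesis using assms by (simp add: n_subsets)
qed

text \<open>
  A random \<open>s\<close>-subset of \<open>I\<close> contains two given elements of \<open>I\<close> with probability at most \<open>s\<^sup>2 / |I|\<^sup>2\<close>.
\<close>

definition seeded_subsets :: "real \<Rightarrow> nat \<Rightarrow> nat set \<Rightarrow> nat set set" where
  "seeded_subsets e s C = {I. I \<subseteq> C \<and> s \<le> card I \<and>
     real (card (sidon_tuples I)) * (real s)\<^sup>2 \<le> e * (real (card I))\<^sup>2}"

lemma ex_sparse_seed:
  assumes I: "finite I" "I \<noteq> {}" and s: "s \<le> card I"
    and e: "real (card (sidon_tuples I)) * (real s)\<^sup>2 \<le> e * (real (card I))\<^sup>2"
  shows "\<exists>S\<in>sidon_subsets e s I. I - S \<in> few_edges_subsets (same_sum_count S) e I"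
proof -
  define E where "E = (\<lambda>(x :: nat, a, y :: nat, b). {a, b :: nat})"
  define Q where "Q S = {q \<in> sidon_tuples I. E q \<subseteq> S}" for S
  have finQ: "finite (Q S)" for S unfolding Q_def using finite_sidon_tuples[OF I(1)] by simp
  have "card (E q) = 2" if "q \<in> sidon_tuples I" for q
    using that by (auto simp: sidon_tuples_def E_def)
  then obtain S where S: "S \<subseteq> I" "card S = s"
    and few: "card (Q S) * (card I)\<^sup>2 \<le> card (sidon_tuples I) * s\<^sup>2"
    unfolding Q_def using ex_subset_few_edges[OF I(1) finite_sidon_tuples[OF I(1)] _ s] by blast
  have "real (card (Q S)) * (real (card I))\<^sup>2 \<le> real (card (sidon_tuples I)) * (real s)\<^sup>2"
    using few by (simp only: of_nat_le_iff flip: of_nat_mult of_nat_power)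
  also note e
  finally have "real (card (Q S)) \<le> e" using I by (simp add: card_gt_0_iff)
  moreover have "card (sidon_tuples S) \<le> card (Q S)"
    using S(1) by (intro card_mono finQ) (auto simp: Q_def E_def sidon_tuples_def)
  moreover have "(\<Sum>u\<in>I - S. \<Sum>v\<in>I - S - {u}. same_sum_count S u v) \<le> card (Q S)"
  proof -
    let ?A = "SIGMA u:I - S. SIGMA v:I - S - {u}. same_sum_pairs S u v"
    have "card ?A \<le> card (Q S)"
    proof (rule card_inj_on_le[OF _ _ finQ])
      show "inj_on (\<lambda>(u, v, a, b). (u, a, v, b)) ?A" by (auto simp: inj_on_def)
      show "(\<lambda>(u, v, a, b). (u, a, v, b)) ` ?A \<subseteq> Q S"
        using S(1) by (auto simp: Q_def E_def sidon_tuples_def same_sum_pairs_def)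
    qed
    then show ?thesis using I(1) finite_subset[OF S(1) I(1)] by (simp add: sum_same_sum_count)
  qed
  ultimately have "real (card (sidon_tuples S)) \<le> e"
    "real (\<Sum>u\<in>I - S. \<Sum>v\<in>I - S - {u}. same_sum_count S u v) \<le> e" by linarith+
  then have "S \<in> sidon_subsets e s I" "I - S \<in> few_edges_subsets (same_sum_count S) e I"
    using S unfolding sidon_subsets_def few_edges_subsets_def by auto
  then show ?thesis by (rule bexI[rotated])
qed

lemma has_containers_few_same_sums:
  assumes U: "U \<subseteq> {1..n}" and S: "S \<subseteq> {1..n}" "S \<noteq> {}"
    and k: "0 < k" "2 * real (card (sidon_tuples S)) \<le> real k * real (card S)" and D: "0 < D"
    and H: "0 \<le> H" "1 + ln (real (card U) * real (card S) / (4 * real n)) \<le> H"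
    and c: "8 * real n / (real (card S))\<^sup>2 * (real k + D) * H \<le> real c" and b: "e \<le> D * real b"
  shows "has_containers (label_count n k c b) (4 * real n / real (card S) + real c + real b) U
    (few_edges_subsets (same_sum_count S) e U)"
proof -
  define s where "s = real (card S)"
  have "0 < card S" "0 < n" using S by (auto simp: card_gt_0_iff intro: finite_subset)
  then have pos: "0 < s" "0 < real n" unfolding s_def by simp_all
  interpret kleitman_winston "same_sum_count S" k D "s\<^sup>2 / (8 * real n)" "4 * real n / s"
    using pos D by unfold_locales auto
  have finU: "finite U" using U by (rule finite_subset) simp
  have dense: "locally_dense U"
    unfolding locally_dense_def
  proof (intro allI impI)
    fix V assume V: "V \<subseteq> U" "4 * real n / s < real (card V)"
    then show "\<exists>u\<in>V. s\<^sup>2 / (8 * real n) * real (card V)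
        \<le> real (\<Sum>v\<in>V - {u}. min (same_sum_count S u v) k)"
      unfolding s_def using U by (intro ex_large_truncated_degree S k) auto
  qed
  have "1 + ln (real (card U) / (4 * real n / s)) \<le> H" using H(2) unfolding s_def by simp
  from cost_le[OF H(1) this] have "cost (real (card U)) \<le> real c"
    using c unfolding s_def by (simp add: mult_ac)
  from has_containers_few_edges[OF finU dense this b] show ?thesis
    unfolding s_def
  proof (rule has_containers_mono)
    show "label_count (card U) k c b \<le> label_count n k c b"
      using card_mono[OF _ U] by (intro label_count_mono) simp
  qed (rule order_refl)+
qed

lemma seeded_subsets_subset:
  assumes "finite C" "0 < s"
  shows "seeded_subsets e s C \<subseteq>
    (\<Union>S\<in>sidon_subsets e s C. (\<union>) S ` few_edges_subsets (same_sum_count S) e C)"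
proof
  fix I assume "I \<in> seeded_subsets e s C"
  then have I: "I \<subseteq> C" "s \<le> card I"
    "real (card (sidon_tuples I)) * (real s)\<^sup>2 \<le> e * (real (card I))\<^sup>2"
    unfolding seeded_subsets_def by auto
  then have "I \<noteq> {}" using assms(2) by auto
  then obtain S where S: "S \<in> sidon_subsets e s I" "I - S \<in> few_edges_subsets (same_sum_count S) e I"
    using ex_sparse_seed[OF finite_subset[OF I(1) assms(1)] _ I(2,3)] by auto
  have "I - S \<in> few_edges_subsets (same_sum_count S) e C"
    using S(2) I(1) unfolding few_edges_subsets_def by auto
  moreover have "I = S \<union> (I - S)" using S(1) unfolding sidon_subsets_def by auto
  ultimately have "I \<in> (\<union>) S ` few_edges_subsets (same_sum_count S) e C" by (rule rev_image_eqI)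
  moreover have "S \<in> sidon_subsets e s C" using S(1) I(1) unfolding sidon_subsets_def by auto
  ultimately show "I \<in> (\<Union>S\<in>sidon_subsets e s C. (\<union>) S ` few_edges_subsets (same_sum_count S) e C)"
    by (rule UN_I[rotated])
qed

lemma has_containers_seeded_subsets:
  assumes C\<^sub>0: "C\<^sub>0 \<subseteq> {1..n}" and s: "0 < s" and k: "0 < k" "2 * e \<le> real k * real s" and D: "0 < D"
    and H: "0 \<le> H" "1 + ln (real (card C\<^sub>0) * real s / (4 * real n)) \<le> H"
    and c: "8 * real n / (real s)\<^sup>2 * (real k + D) * H \<le> real c" and b: "e \<le> D * real b"
  shows "has_containers (real (card C\<^sub>0 choose s) * label_count n k c b)
    (4 * real n / real s + real s + real c + real b) C\<^sub>0 (seeded_subsets e s C\<^sub>0)"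
    (is "has_containers _ ?r _ _")
proof -
  let ?\<S> = "sidon_subsets e s C\<^sub>0"
  let ?\<J> = "\<lambda>S. few_edges_subsets (same_sum_count S) e C\<^sub>0"
  have finC: "finite C\<^sub>0" using C\<^sub>0 by (rule finite_subset) simp
  have "has_containers (label_count n k c b) ?r C\<^sub>0 ((\<union>) S ` ?\<J> S)" if "S \<in> ?\<S>" for S
  proof -
    have S: "S \<subseteq> C\<^sub>0" "card S = s" "real (card (sidon_tuples S)) \<le> e"
      using that unfolding sidon_subsets_def by auto
    then have "S \<subseteq> {1..n}" "S \<noteq> {}" "2 * real (card (sidon_tuples S)) \<le> real k * real (card S)"
      using C\<^sub>0 s k(2) by auto
    then have "has_containers (label_count n k c b) (4 * real n / real s + real c + real b) C\<^sub>0 (?\<J> S)"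
      using has_containers_few_same_sums[OF C\<^sub>0 _ _ k(1) _ D H(1) _ _ b, of S c] H(2) c S(2) by simp
    from has_containers_image_Un[OF this, of S] show ?thesis
      by (rule has_containers_mono) (use S(1,2) in auto)
  qed
  then have "has_containers (\<Sum>S\<in>?\<S>. label_count n k c b) ?r C\<^sub>0 (\<Union>S\<in>?\<S>. (\<union>) S ` ?\<J> S)"
    using finC by (intro has_containers_UN finite_sidon_subsets)
  then show ?thesis
  proof (rule has_containers_mono)
    show "(\<Sum>S\<in>?\<S>. label_count n k c b) \<le> real (card C\<^sub>0 choose s) * label_count n k c b"
      unfolding sum_constant
      by (intro mult_right_mono card_sidon_subsets_le_binomial finC label_count_nonneg)
  qed (rule seeded_subsets_subset[OF finC s] order_refl)+
qed

subsection \<open>Iterating with doubled seeds\<close>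

lemma card_sidon_subsets_le_containers:
  assumes "has_containers N r C\<^sub>0 (sidon_subsets \<alpha> m C\<^sub>0)" "finite C\<^sub>0" "0 \<le> X"
    and "\<And>C. C \<subseteq> C\<^sub>0 \<Longrightarrow> real (card C) \<le> r \<Longrightarrow> real (card (sidon_subsets \<alpha> m C)) \<le> X"
  shows "real (card (sidon_subsets \<alpha> m C\<^sub>0)) \<le> N * X"
proof -
  obtain \<C> where \<C>: "finite \<C>" "\<C> \<subseteq> Pow C\<^sub>0" "real (card \<C>) \<le> N"
    "\<And>C. C \<in> \<C> \<Longrightarrow> real (card C) \<le> r" "\<And>I. I \<in> sidon_subsets \<alpha> m C\<^sub>0 \<Longrightarrow> \<exists>C\<in>\<C>. I \<subseteq> C"
    using assms(1) unfolding has_containers_def by auto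
  have "sidon_subsets \<alpha> m C\<^sub>0 \<subseteq> (\<Union>C\<in>\<C>. sidon_subsets \<alpha> m C)"
    using \<C>(5) by (fastforce simp: sidon_subsets_def)
  moreover have "finite (\<Union>C\<in>\<C>. sidon_subsets \<alpha> m C)"
  proof (intro finite_UN_I \<C>(1) finite_sidon_subsets)
    show "finite C" if "C \<in> \<C>" for C using that \<C>(2) by (intro finite_subset[OF _ assms(2)]) auto
  qed
  ultimately have "card (sidon_subsets \<alpha> m C\<^sub>0) \<le> card (\<Union>C\<in>\<C>. sidon_subsets \<alpha> m C)"
    by (rule card_mono[rotated])
  also have "\<dots> \<le> (\<Sum>C\<in>\<C>. card (sidon_subsets \<alpha> m C))" using \<C>(1) by (rule card_UN_le)
  finally have "real (card (sidon_subsets \<alpha> m C\<^sub>0)) \<le> (\<Sum>C\<in>\<C>. real (card (sidon_subsets \<alpha> m C)))"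
    by (simp only: of_nat_le_iff flip: of_nat_sum)
  also have "\<dots> \<le> real (card \<C>) * X" using assms(4) \<C>(2,4) by (intro sum_bounded_above) auto
  also have "\<dots> \<le> N * X" using \<C>(3) assms(3) by (rule mult_right_mono)
  finally show ?thesis .
qed

text \<open>
  With a seed of size \<open>s\<close>, a degree bound \<open>D = d s\<^sup>2\<close> allows for \<open>8 n d H\<close> elements lost by the
  algorithm, where \<open>H\<close> bounds its logarithmic factor, and for \<open>1 / (d (log 2 n)\<^sup>3)\<close> elements of large
  degree. The last summand but one results from a choice of \<open>d\<close> that balances the two.
\<close>

definition stage_cost :: "nat \<Rightarrow> real \<Rightarrow> real" where
  "stage_cost n H = (16 * sqrt (real n) / (log 2 (real n))\<^sup>2 + 16 * (log 2 (real n))\<^sup>2) * H +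
     9 * sqrt (real n) * sqrt (H / log 2 (real n) ^ 3) + 2"

definition total_cost :: "nat \<Rightarrow> real" where
  "total_cost n = 132 * sqrt (real n) + 48 * log 2 (real n) ^ 4 + 7 * log 2 (real n) +
     3 * log 2 (real n) * stage_cost n 3 * log 2 (log 2 (real n))"

lemma exp_le_two_powr:
  fixes y :: real
  assumes "0 \<le> y"
  shows "exp (4 * y) \<le> 2 powr (6 * y)"
  using mult_left_mono[OF ln2_ge_two_thirds, of "6 * y"] assms by (simp add: powr_def)

locale large_interval =
  fixes n :: nat and L r :: real
  defines "L \<equiv> log 2 (real n)" and "r \<equiv> sqrt (real n)"
  assumes L_ge_1: "1 \<le> L" and n_large: "2 * r + 3 \<le> real n"
    and first_seed: "r / L + 1 \<le> r / sqrt L"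
    and stage_costs: "stage_cost n L \<le> r" "stage_cost n 3 \<le> r"
begin

lemma L_pos: "0 < L" using L_ge_1 by simp

lemma n_ge_3: "3 \<le> real n"
  using n_large unfolding r_def by (smt (verit) real_sqrt_ge_zero of_nat_0_le_iff)

lemma r_pos: "0 < r" and n_eq: "real n = r\<^sup>2"
  using n_ge_3 unfolding r_def by auto

lemma seed_pos: "r / L \<le> real s \<Longrightarrow> 0 < s"
  using divide_pos_pos[OF r_pos L_pos] by (cases s) auto

lemma two_powr_L: "2 powr L = real n"
  unfolding L_def using n_ge_3 by simp

lemma Suc_n_le: "real (n + 1) \<le> 2 powr (2 * L)"
proof -
  have "3 * real n \<le> real n * real n" using n_ge_3 by (intro mult_right_mono) auto
  moreover have "2 powr (2 * L) = real n ^ 2"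
    by (simp add: two_powr_L powr_numeral mult.commute[of 2] flip: powr_powr)
  ultimately show ?thesis using n_ge_3 unfolding power2_eq_square of_nat_add of_nat_1 by linarith
qed

lemma stage_cost_eq: "stage_cost n H = (16 * r / L\<^sup>2 + 16 * L\<^sup>2) * H + 9 * r * sqrt (H / L ^ 3) + 2"
  unfolding stage_cost_def L_def r_def ..

lemma total_cost_eq:
  "total_cost n = L * (r / L + 1) + 3 * L * stage_cost n L +
    (56 * r + 3 * L * stage_cost n 3 * log 2 L)"
proof -
  have "sqrt (L / L ^ 3) = 1 / L"
    using L_pos by (intro real_sqrt_unique) (simp_all add: power2_eq_square power3_eq_cube)
  then have "L * (9 * r * sqrt (L / L ^ 3)) = 9 * r" using L_pos by simp
  moreover have "L * ((16 * r / L\<^sup>2 + 16 * L\<^sup>2) * L) = 16 * r + 16 * L ^ 4"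
    using L_pos by (simp add: field_simps power2_eq_square power4_eq_xxxx)
  ultimately have "L * stage_cost n L = 25 * r + 16 * L ^ 4 + 2 * L"
    unfolding stage_cost_eq by (simp only: distrib_left)
  moreover have "total_cost n = 132 * r + 48 * L ^ 4 + 7 * L + 3 * L * stage_cost n 3 * log 2 L"
    unfolding total_cost_def L_def r_def ..
  moreover have "L * (r / L + 1) = r + L" using L_pos by (simp add: distrib_left)
  ultimately show ?thesis by linarith
qed

lemma label_count_le:
  assumes "real k + 1 \<le> real n"
  shows "label_count n k c b \<le> 2 powr (3 * L * (real c + real b))"
proof -
  have cube: "2 powr (3 * L) = real n ^ 3"
    by (simp add: two_powr_L powr_numeral mult.commute[of 3] flip: powr_powr)
  have "1 * real n \<le> real n * real n" using n_ge_3 by (intro mult_right_mono) auto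
  moreover have "real n * (real n + (real k + 1)) \<le> real n * (real n + real n)"
    using assms by (intro mult_left_mono) auto
  moreover have "3 * (real n * real n) \<le> real n * (real n * real n)"
    using n_ge_3 by (intro mult_right_mono) auto
  ultimately have "real (n * (n + k) + 1) \<le> 2 powr (3 * L)" "real (n + 1) \<le> 2 powr (3 * L)"
    unfolding cube power3_eq_cube of_nat_add of_nat_mult distrib_left mult.assoc of_nat_1
    using n_ge_3 by linarith+
  then have "label_count n k c b \<le> (2 powr (3 * L)) ^ c * (2 powr (3 * L)) ^ b"
    unfolding label_count_def by (intro mult_mono power_mono) auto
  also have "\<dots> = 2 powr (3 * L * (real c + real b))"
    by (simp add: powr_powr distrib_left powr_add flip: powr_realpow)
  finally show ?thesis .
qed

lemma seed_cost_le:
  assumes s: "0 < s" "r / L \<le> s" and k: "k \<le> 2 * s / L ^ 3 + 2" and g: "0 < g" "g * g = H / L ^ 3"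
  shows "8 * real n / s\<^sup>2 * (k + s\<^sup>2 / (r * g * L ^ 3)) * H
    \<le> (16 * r / L\<^sup>2 + 16 * L\<^sup>2) * H + 8 * (r * g)"
proof -
  have "0 < H / L ^ 3" using g by (metis mult_pos_pos)
  then have H: "0 \<le> H" using L_pos by (simp add: zero_less_divide_iff)
  have rs: "r / s \<le> L" using s L_pos by (simp add: field_simps)
  have "8 * real n / s\<^sup>2 * k \<le> 8 * real n / s\<^sup>2 * (2 * s / L ^ 3 + 2)"
    using k by (intro mult_left_mono) auto
  also have "\<dots> = 16 * r * (r / s) / L ^ 3 + 16 * (r / s)\<^sup>2"
    unfolding n_eq using s L_pos by (simp add: field_simps power2_eq_square)
  also have "\<dots> \<le> 16 * r * L / L ^ 3 + 16 * L\<^sup>2"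
    using rs r_pos s L_pos
    by (intro add_mono mult_left_mono divide_right_mono power_mono order_refl) auto
  also have "16 * r * L / L ^ 3 = 16 * r / L\<^sup>2"
    using L_pos by (simp add: power2_eq_square power3_eq_cube)
  finally have "8 * real n / s\<^sup>2 * k * H \<le> (16 * r / L\<^sup>2 + 16 * L\<^sup>2) * H"
    using H by (rule mult_right_mono)
  moreover have "8 * real n / s\<^sup>2 * (s\<^sup>2 / (r * g * L ^ 3)) * H = 8 * r * (H / L ^ 3) / g"
    unfolding n_eq using s r_pos by (simp add: power2_eq_square mult_ac)
  moreover have "\<dots> = 8 * (r * g)" unfolding g(2)[symmetric] using g(1) by simp
  ultimately show ?thesis by (simp only: distrib_left distrib_right)
qed

lemma sidon_subsets_subset_seeded_subsets:
  assumes "r / sqrt L \<le> real m" "s \<le> m"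
  shows "sidon_subsets (real n / L ^ 4) m C \<subseteq> seeded_subsets ((real s)\<^sup>2 / L ^ 3) s C"
proof
  fix I assume I: "I \<in> sidon_subsets (real n / L ^ 4) m C"
  have "(r / sqrt L)\<^sup>2 \<le> (real m)\<^sup>2" using assms(1) r_pos L_pos by (intro power_mono) auto
  then have "real n / L / L ^ 3 \<le> (real m)\<^sup>2 / L ^ 3"
    using L_pos by (intro divide_right_mono) (auto simp: power_divide n_eq)
  moreover have "real n / L / L ^ 3 = real n / L ^ 4" by (simp add: eval_nat_numeral)
  ultimately have "real (card (sidon_tuples I)) \<le> (real (card I))\<^sup>2 / L ^ 3"
    using I unfolding sidon_subsets_def by auto
  then have "real (card (sidon_tuples I)) * (real s)\<^sup>2 \<le> (real (card I))\<^sup>2 / L ^ 3 * (real s)\<^sup>2"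
    by (rule mult_right_mono) simp
  then show "I \<in> seeded_subsets ((real s)\<^sup>2 / L ^ 3) s C"
    using I assms(2) unfolding sidon_subsets_def seeded_subsets_def by (simp add: mult.commute)
qed

lemma ex_has_containers_seed:
  assumes C\<^sub>0: "C\<^sub>0 \<subseteq> {1..n}" and s: "real s \<le> r" "r / L \<le> real s"
    and H: "0 < H" "1 + ln (real (card C\<^sub>0) * real s / (4 * real n)) \<le> H"
  obtains k c b where "real k + 1 \<le> real n" "real c + real b \<le> stage_cost n H"
    "has_containers (real (card C\<^sub>0 choose s) * label_count n k c b)
      (4 * real n / real s + real s + real c + real b) C\<^sub>0
      (seeded_subsets ((real s)\<^sup>2 / L ^ 3) s C\<^sub>0)"
proof -
  have s_pos: "0 < s" using s(2) by (rule seed_pos)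
  define g where "g = sqrt (H / L ^ 3)"
  have g: "0 < g" "g * g = H / L ^ 3" unfolding g_def using H(1) L_pos by auto
  define D where "D = (real s)\<^sup>2 / (r * g * L ^ 3)"
  define k where "k = nat \<lceil>2 * real s / L ^ 3\<rceil> + 1"
  define b where "b = nat \<lceil>r * g\<rceil>"
  define c where "c = nat \<lceil>(16 * r / L\<^sup>2 + 16 * L\<^sup>2) * H + 8 * (r * g)\<rceil>"
  have "0 \<le> 2 * real s / L ^ 3" using L_pos by simp
  then have k: "0 < k" "2 * real s / L ^ 3 \<le> real k" "real k \<le> 2 * real s / L ^ 3 + 2"
    unfolding k_def by linarith+
  have D: "0 < D" unfolding D_def using s_pos r_pos g(1) L_pos by simp
  have rg: "0 \<le> r * g" using r_pos g(1) by simp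
  then have b: "r * g \<le> real b" "real b \<le> r * g + 1" unfolding b_def by linarith+
  have "0 \<le> (16 * r / L\<^sup>2 + 16 * L\<^sup>2) * H" using r_pos H(1) by simp
  with rg have c: "(16 * r / L\<^sup>2 + 16 * L\<^sup>2) * H + 8 * (r * g) \<le> real c"
      "real c \<le> (16 * r / L\<^sup>2 + 16 * L\<^sup>2) * H + 8 * (r * g) + 1"
    unfolding c_def by linarith+
  show thesis
  proof (rule that)
    have "real s / L ^ 3 \<le> real s" using s_pos L_ge_1 by (simp add: divide_le_eq)
    then show "real k + 1 \<le> real n" using k(3) n_large s(1) by linarith
    show "real c + real b \<le> stage_cost n H"
      unfolding stage_cost_eq g_def[symmetric] using b(2) c(2) by linarith
    have "2 * ((real s)\<^sup>2 / L ^ 3) \<le> real k * real s"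
      using mult_right_mono[OF k(2), of "real s"] by (simp add: power2_eq_square)
    moreover have "8 * real n / (real s)\<^sup>2 * (real k + D) * H \<le> real c"
      using seed_cost_le[OF _ s(2) k(3) g] c(1) s_pos unfolding D_def by simp
    moreover have "(real s)\<^sup>2 / L ^ 3 = D * (r * g)" unfolding D_def using r_pos g(1) by simp
    then have "(real s)\<^sup>2 / L ^ 3 \<le> D * real b" using mult_left_mono[OF b(1), of D] D by simp
    ultimately show "has_containers (real (card C\<^sub>0 choose s) * label_count n k c b)
      (4 * real n / real s + real s + real c + real b) C\<^sub>0
      (seeded_subsets ((real s)\<^sup>2 / L ^ 3) s C\<^sub>0)"
      using H by (intro has_containers_seeded_subsets[OF C\<^sub>0 s_pos k(1) _ D]) auto
  qed
qed

lemma has_containers_sidon_subsets: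
  assumes C\<^sub>0: "C\<^sub>0 \<subseteq> {1..n}" and s: "s \<le> m" "real s \<le> r" "r / L \<le> real s" and m: "r / sqrt L \<le> real m"
    and H: "0 < H" "1 + ln (real (card C\<^sub>0) * real s / (4 * real n)) \<le> H" "stage_cost n H \<le> r"
  shows "has_containers (real (card C\<^sub>0 choose s) * 2 powr (3 * L * stage_cost n H))
    (6 * real n / real s) C\<^sub>0 (sidon_subsets (real n / L ^ 4) m C\<^sub>0)"
proof -
  obtain k c b where k: "real k + 1 \<le> real n" and cb: "real c + real b \<le> stage_cost n H"
    and containers: "has_containers (real (card C\<^sub>0 choose s) * label_count n k c b)
      (4 * real n / real s + real s + real c + real b) C\<^sub>0
      (seeded_subsets ((real s)\<^sup>2 / L ^ 3) s C\<^sub>0)"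
    using ex_has_containers_seed[OF C\<^sub>0 s(2,3) H(1,2)] .
  show ?thesis
  proof (rule has_containers_mono[OF containers])
    have "label_count n k c b \<le> 2 powr (3 * L * (real c + real b))"
      using k by (rule label_count_le)
    also have "\<dots> \<le> 2 powr (3 * L * stage_cost n H)"
      using cb L_pos by (intro powr_mono mult_left_mono) auto
    finally show "real (card C\<^sub>0 choose s) * label_count n k c b
        \<le> real (card C\<^sub>0 choose s) * 2 powr (3 * L * stage_cost n H)"
      by (rule mult_left_mono) simp
    have "r \<le> real n / real s"
      using mult_left_mono[OF s(2), of r] seed_pos[OF s(3)] r_pos unfolding n_eq
      by (simp add: field_simps power2_eq_square)
    then show "4 * real n / real s + real s + real c + real b \<le> 6 * real n / real s"
      using cb H(3) s(2) by linarith
  qed (simp_all add: sidon_subsets_subset_seeded_subsets m s(1))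
qed

lemma container_choose_le:
  assumes "0 < s" "real (card C) \<le> 6 * real n / real s" "j \<le> 2 * s"
  shows "real (card C choose j) \<le> 2 powr (16 * sqrt (real s * r))"
proof -
  define z where "z = sqrt (real s * r)"
  have z: "0 \<le> z" "z\<^sup>2 = real s * r" unfolding z_def using r_pos by auto
  have "real j ^ (4 - 1) * real (card C) \<le> (2 * real s) ^ (4 - 1) * (6 * real n / real s)"
    using assms by (intro mult_mono power_mono) auto
  also have "\<dots> = 48 * (z\<^sup>2)\<^sup>2"
    unfolding z(2) n_eq using assms(1) by (simp add: eval_nat_numeral field_simps)
  also have "\<dots> \<le> (8 / 3 * z) ^ 4" by (simp add: power_mult_distrib power_divide)
  finally have "real (card C choose j) \<le> exp (4 * (8 / 3 * z))"
    using z(1) binomial_le_exp[of 4 "8 / 3 * z" j "card C"] by simp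
  also have "\<dots> \<le> 2 powr (6 * (8 / 3 * z))" using z(1) by (intro exp_le_two_powr) auto
  finally show ?thesis unfolding z_def by simp
qed

text \<open>
  The first two terms come from the binomial coefficients of the stages that follow a seed of size \<open>s\<close>,
  whose exponents form a geometric sum, and the last one from the costs of these \<open>log 2 (r / s)\<close> stages.
\<close>

definition exponent :: "nat \<Rightarrow> real" where
  "exponent s = 56 * r - 40 * sqrt (real s * r) + 3 * L * stage_cost n 3 * log 2 (r / real s)"

lemma stage_cost_nonneg: "0 \<le> H \<Longrightarrow> 0 \<le> stage_cost n H"
  unfolding stage_cost_eq using r_pos L_pos by simp

lemma exponent_ge:
  assumes "0 < s" "real s \<le> r"
  shows "16 * sqrt (real s * r) \<le> exponent s" "16 * r \<le> exponent s"
proof -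
  have "sqrt (real s * r) \<le> sqrt (r * r)"
    using assms r_pos by (intro real_sqrt_le_mono mult_right_mono) auto
  then have "sqrt (real s * r) \<le> r" using r_pos by simp
  moreover have "0 \<le> 3 * L * stage_cost n 3 * log 2 (r / real s)"
    using assms L_pos stage_cost_nonneg by simp
  ultimately show "16 * sqrt (real s * r) \<le> exponent s" "16 * r \<le> exponent s"
    unfolding exponent_def by linarith+
qed

lemma exponent_double:
  assumes "0 < s"
  shows "16 * sqrt (real s * r) + 3 * L * stage_cost n 3 + exponent (2 * s) \<le> exponent s"
proof -
  have "7 / 5 \<le> sqrt (2 :: real)" by (rule real_le_rsqrt) (simp add: power2_eq_square)
  then have "7 / 5 * sqrt (real s * r) \<le> sqrt 2 * sqrt (real s * r)"
    using r_pos by (intro mult_right_mono) auto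
  also have "\<dots> = sqrt (real (2 * s) * r)" by (simp add: real_sqrt_mult)
  finally have "7 / 5 * sqrt (real s * r) \<le> sqrt (real (2 * s) * r)" .
  moreover have "log 2 (r / real (2 * s)) = log 2 (r / real s) - 1"
    using assms r_pos by (simp add: log_divide log_mult)
  ultimately show ?thesis unfolding exponent_def by (simp add: right_diff_distrib)
qed

lemma container_log_factor_le:
  assumes "0 < s" "real (card C) \<le> 6 * real n / real s"
  shows "1 + ln (real (card C) * real (2 * s) / (4 * real n)) \<le> 3"
proof (cases "card C = 0")
  case False
  define y where "y = real (card C) * real (2 * s) / (4 * real n)"
  have "real (card C) * real s \<le> 6 * real n" using assms by (simp add: field_simps)
  then have "y \<le> 3" unfolding y_def using n_ge_3 by (simp add: field_simps)
  moreover have "0 < y" unfolding y_def using False assms(1) n_ge_3 by simp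
  ultimately show ?thesis using ln_le_minus_one[of y] unfolding y_def[symmetric] by linarith
qed simp

lemma card_sidon_subsets_le_last_stage:
  assumes s: "0 < s" "real s \<le> r" and C: "finite C" "real (card C) \<le> 6 * real n / real s"
    and last: "m < 2 * s \<or> r < 2 * real s"
  shows "real (card (sidon_subsets \<alpha> m C)) \<le> 2 powr exponent s"
proof -
  have "real (card C choose m) \<le> 2 powr exponent s"
    using last
  proof
    assume "m < 2 * s"
    then have "real (card C choose m) \<le> 2 powr (16 * sqrt (real s * r))"
      using s(1) C(2) by (intro container_choose_le) auto
    also have "\<dots> \<le> 2 powr exponent s" using exponent_ge(1)[OF s] by (rule powr_mono) simp
    finally show ?thesis .
  next
    assume "r < 2 * real s"
    then have "6 * real n / real s \<le> 12 * r"
      unfolding n_eq using s(1) r_pos by (simp add: field_simps power2_eq_square)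
    then have "real (card C) \<le> exponent s" using C(2) exponent_ge(2)[OF s] r_pos by linarith
    have "real (card C choose m) \<le> real (2 ^ card C)" using binomial_le_pow2 by (rule of_nat_mono)
    also have "\<dots> = 2 powr real (card C)" by (simp add: powr_realpow)
    also have "\<dots> \<le> 2 powr exponent s" using \<open>real (card C) \<le> exponent s\<close> by (rule powr_mono) simp
    finally show ?thesis .
  qed
  then show ?thesis using card_sidon_subsets_le_binomial[OF C(1), of \<alpha> m] by linarith
qed

lemma card_sidon_subsets_container:
  assumes m: "r / sqrt L \<le> real m"
    and "s \<le> m" "real s \<le> r" "r / L \<le> real s" "C \<subseteq> {1..n}" "real (card C) \<le> 6 * real n / real s"
  shows "real (card (sidon_subsets (real n / L ^ 4) m C)) \<le> 2 powr exponent s"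
  using assms(2-)
proof (induction "m - s" arbitrary: s C rule: less_induct)
  case less
  have s: "0 < s" using less.prems(3) by (rule seed_pos)
  have fin: "finite C" using less.prems(4) by (rule finite_subset) simp
  show ?case
  proof (cases "m < 2 * s \<or> r < 2 * real s")
    case True
    then show ?thesis by (intro card_sidon_subsets_le_last_stage s fin less.prems)
  next
    case False
    then have double: "2 * s \<le> m" "real (2 * s) \<le> r" "r / L \<le> real (2 * s)" using less.prems(3) by auto
    have "has_containers (real (card C choose (2 * s)) * 2 powr (3 * L * stage_cost n 3))
        (6 * real n / real (2 * s)) C (sidon_subsets (real n / L ^ 4) m C)"
      using container_log_factor_le[OF s less.prems(5)]
      by (intro has_containers_sidon_subsets less.prems double m stage_costs) auto
    then have "real (card (sidon_subsets (real n / L ^ 4) m C))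
        \<le> real (card C choose (2 * s)) * 2 powr (3 * L * stage_cost n 3) * 2 powr exponent (2 * s)"
    proof (rule card_sidon_subsets_le_containers[OF _ fin])
      fix C' assume "C' \<subseteq> C" "real (card C') \<le> 6 * real n / real (2 * s)"
      then show "real (card (sidon_subsets (real n / L ^ 4) m C')) \<le> 2 powr exponent (2 * s)"
        using less.prems(1,4) s double by (intro less.hyps) auto
    qed simp
    also have "\<dots> \<le> 2 powr (16 * sqrt (real s * r)) * 2 powr (3 * L * stage_cost n 3) *
        2 powr exponent (2 * s)"
      using container_choose_le[OF s less.prems(5)] by (intro mult_right_mono) auto
    also have "\<dots> \<le> 2 powr exponent s"
      using exponent_double[OF s] by (simp flip: powr_add)
    finally show ?thesis .
  qed
qed

lemma first_log_factor_le:
  assumes "0 < s" "real s \<le> r"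
  shows "1 + ln (real n * real s / (4 * real n)) \<le> L"
proof -
  have "1 + ln (real n * real s / (4 * real n)) = 1 + ln (real s) - 2 * ln 2"
    using assms(1) n_ge_3 ln_realpow[of 2 2] by (simp add: ln_div)
  also have "\<dots> \<le> ln (real s)" using ln2_ge_two_thirds by linarith
  also have "\<dots> \<le> ln (real n)" using assms n_large by simp
  also have "\<dots> = L * ln 2" unfolding L_def log_def by simp
  also have "\<dots> \<le> L * 1" using L_pos ln_2_less_1 by (intro mult_left_mono) auto
  finally show ?thesis by simp
qed

lemma exponent_le:
  assumes "r / L \<le> real s"
  shows "exponent s \<le> 56 * r + 3 * L * stage_cost n 3 * log 2 L"
proof -
  have s: "0 < s" using assms by (rule seed_pos)
  then have "r / real s \<le> L" using assms L_pos by (simp add: field_simps)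
  then have "log 2 (r / real s) \<le> log 2 L" using r_pos s L_pos by simp
  then have "3 * L * stage_cost n 3 * log 2 (r / real s) \<le> 3 * L * stage_cost n 3 * log 2 L"
    using L_pos stage_cost_nonneg by (intro mult_left_mono) auto
  moreover have "0 \<le> sqrt (real s * r)" using r_pos by simp
  ultimately show ?thesis unfolding exponent_def by linarith
qed

lemma choose_le_two_powr: "real (n choose s) \<le> 2 powr (L * real s)"
proof -
  have "real (n choose s) \<le> real (n ^ s)" by (intro of_nat_mono choose_le_power)
  also have "\<dots> = 2 powr (L * real s)"
    using n_ge_3 by (simp add: two_powr_L powr_realpow flip: powr_powr)
  finally show ?thesis .
qed

lemma card_sidon_subsets_le:
  assumes m: "r / sqrt L \<le> real m"
  shows "real (card (sidon_subsets (real n / L ^ 4) m {1..n})) \<le> 2 powr total_cost n"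
proof -
  define s where "s = nat \<lceil>r / L\<rceil>"
  have "0 < r / L" using r_pos L_pos by simp
  then have s: "r / L \<le> real s" "real s \<le> r / L + 1" "0 < s" unfolding s_def by linarith+
  have "r / sqrt L \<le> r" using r_pos L_ge_1 by (simp add: divide_le_eq)
  then have s_le: "s \<le> m" "real s \<le> r" using s(2) first_seed m by linarith+
  have "L * real s \<le> L * (r / L + 1)" using s(2) L_pos by (intro mult_left_mono) auto
  then have "2 powr (L * real s) \<le> 2 powr (L * (r / L + 1))" by (intro powr_mono) auto
  with choose_le_two_powr have first_choice: "real (n choose s) \<le> 2 powr (L * (r / L + 1))"
    by (rule order_trans)
  have "has_containers (real (card {1..n} choose s) * 2 powr (3 * L * stage_cost n L))
      (6 * real n / real s) {1..n} (sidon_subsets (real n / L ^ 4) m {1..n})"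
    using first_log_factor_le[OF s(3) s_le(2)] L_pos
    by (intro has_containers_sidon_subsets s_le s(1) m stage_costs) auto
  then have "real (card (sidon_subsets (real n / L ^ 4) m {1..n}))
      \<le> real (n choose s) * 2 powr (3 * L * stage_cost n L) * 2 powr exponent s"
    using card_sidon_subsets_container[OF m s_le s(1)]
      card_sidon_subsets_le_containers[of _ _ "{1..n}"] by simp
  also have "\<dots> \<le> 2 powr (L * (r / L + 1)) * 2 powr (3 * L * stage_cost n L)
      * 2 powr (56 * r + 3 * L * stage_cost n 3 * log 2 L)"
    using first_choice by (intro mult_mono powr_mono exponent_le s(1)) (use L_pos stage_cost_nonneg in auto)
  also have "\<dots> = 2 powr total_cost n" unfolding total_cost_eq by (simp only: powr_add)
  finally show ?thesis .
qed

lemma card_small_subsets_le: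
  "real (card {I. I \<subseteq> {1..n} \<and> real (card I) \<le> r / L}) \<le> 2 powr (2 * r)"
proof -
  define K where "K = nat \<lfloor>r / L\<rfloor>"
  have K: "real K \<le> r / L" unfolding K_def using r_pos L_pos by (intro of_nat_floor) auto
  have "card I \<le> K" if "real (card I) \<le> r / L" for I :: "nat set"
    unfolding K_def using that by (rule le_nat_floor)
  then have "card {I. I \<subseteq> {1..n} \<and> real (card I) \<le> r / L} \<le> card {I. I \<subseteq> {1..n} \<and> card I \<le> K}"
    by (intro card_mono) auto
  also have "\<dots> \<le> (n + 1) ^ K" using card_subsets_card_le[of "{1..n}" K] by simp
  finally have "real (card {I. I \<subseteq> {1..n} \<and> real (card I) \<le> r / L}) \<le> real (n + 1) ^ K"
    by (simp only: of_nat_le_iff flip: of_nat_power)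
  also have "\<dots> \<le> (2 powr (2 * L)) ^ K" using Suc_n_le by (intro power_mono) auto
  also have "\<dots> = 2 powr (2 * (L * real K))" by (simp add: powr_powr mult.assoc flip: powr_realpow)
  also have "\<dots> \<le> 2 powr (2 * r)"
  proof -
    have "L * real K \<le> r" using K L_pos by (simp add: field_simps)
    then show ?thesis by (intro powr_mono) auto
  qed
  finally show ?thesis .
qed

lemma sidon_family_subset:
  "sidon_family n (real n / L ^ 4) \<subseteq> {I. I \<subseteq> {1..n} \<and> real (card I) \<le> r / L} \<union>
    (\<Union>m\<in>{m \<in> {0..n}. r / sqrt L \<le> real m}. sidon_subsets (real n / L ^ 4) m {1..n})"
proof
  fix I assume I: "I \<in> sidon_family n (real n / L ^ 4)"
  then have "card I \<le> n" using card_mono[of "{1..n}" I]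
    by (auto simp: sidon_family_def generalized_sidon_def)
  then show "I \<in> {I. I \<subseteq> {1..n} \<and> real (card I) \<le> r / L} \<union>
      (\<Union>m\<in>{m \<in> {0..n}. r / sqrt L \<le> real m}. sidon_subsets (real n / L ^ 4) m {1..n})"
    using I unfolding sidon_family_def generalized_sidon_def sidon_subsets_def L_def r_def by auto
qed

lemma card_sidon_family_le:
  "real (card (sidon_family n (real n / L ^ 4))) \<le> 2 powr (2 * L + total_cost n + 1)"
proof -
  let ?small = "{I. I \<subseteq> {1..n} \<and> real (card I) \<le> r / L}"
  let ?M = "{m \<in> {0..n}. r / sqrt L \<le> real m}"
  let ?F = "\<lambda>m. sidon_subsets (real n / L ^ 4) m {1..n}"
  have "card (sidon_family n (real n / L ^ 4)) \<le> card (?small \<union> (\<Union>m\<in>?M. ?F m))"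
    using sidon_family_subset by (rule card_mono[rotated]) (simp add: finite_sidon_subsets)
  also have "\<dots> \<le> card ?small + (\<Sum>m\<in>?M. card (?F m))"
    by (intro order_trans[OF card_Un_le] add_left_mono card_UN_le) simp
  finally have "real (card (sidon_family n (real n / L ^ 4)))
      \<le> real (card ?small) + (\<Sum>m\<in>?M. real (card (?F m)))"
    by (simp only: of_nat_le_iff flip: of_nat_add of_nat_sum)
  also have "\<dots> \<le> 2 powr (2 * r) + real (card ?M) * 2 powr total_cost n"
    by (intro add_mono card_small_subsets_le sum_bounded_above card_sidon_subsets_le) auto
  also have "\<dots> \<le> 2 powr (2 * L + total_cost n) + 2 powr (2 * L) * 2 powr total_cost n"
  proof (intro add_mono mult_right_mono powr_mono)
    have "0 \<le> 3 * L * stage_cost n 3 * log 2 L" "0 \<le> 3 * L * stage_cost n L" "0 \<le> L * (r / L + 1)"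
      using L_ge_1 r_pos stage_cost_nonneg by auto
    then show "2 * r \<le> 2 * L + total_cost n" unfolding total_cost_eq using r_pos L_pos by linarith
    have "card ?M \<le> card {0..n}" by (intro card_mono) auto
    then show "real (card ?M) \<le> 2 powr (2 * L)" using Suc_n_le by simp
  qed auto
  also have "\<dots> = 2 powr (2 * L + total_cost n + 1)" by (simp add: powr_add)
  finally show ?thesis .
qed

end

theorem theorem1p1:
  shows "\<exists>n\<^sub>0. \<forall>n\<ge>n\<^sub>0.
    real (card (sidon_family n (real n / (log 2 (real n)) ^ 4))) \<le> 2 powr (180 * sqrt (real n))"
proof -
  have "\<forall>\<^sub>F n :: nat in sequentially. large_interval n"
    unfolding large_interval_def stage_cost_def by (intro eventually_conj; real_asymp)
  moreover have "\<forall>\<^sub>F n :: nat in sequentially.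
      2 * log 2 (real n) + total_cost n + 1 \<le> 180 * sqrt (real n)"
    unfolding total_cost_def stage_cost_def by real_asymp
  ultimately have "\<forall>\<^sub>F n in sequentially.
      real (card (sidon_family n (real n / (log 2 (real n)) ^ 4))) \<le> 2 powr (180 * sqrt (real n))"
  proof eventually_elim
    case (elim n)
    then interpret large_interval n "log 2 (real n)" "sqrt (real n)" by simp_all
    note card_sidon_family_le
    also have "2 powr (2 * log 2 (real n) + total_cost n + 1) \<le> 2 powr (180 * sqrt (real n))"
      using elim(2) by (intro powr_mono) auto
    finally show ?case .
  qed
  then show ?thesis unfolding eventually_sequentially .
qed

end
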